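(* Let $n\ge 1$ and let $P\subseteq[0,1]^n$ be a polyhedron. Suppose that (i') $P$ has a collapsible triangulation; (ii) $P$ contains a vertex of $[0,1]^n$; (iii) $P$ has a strongly regular triangulation. Then $P$ is a $\mathbb{Z}$-retract of $[0,1]^n$.
   Context: A polyhedron in $[0,1]^n$ is a finite union of (closed) simplexes contained in $[0,1]^n$; it is rational if the simplexes can be chosen with rational vertices. A triangulation of a polyhedron $P$ is a finite simplicial complex $\Delta$ (of closed simplexes) whose point-set union $|\Delta|$ is $P$. Collapsibility: an $m$-simplex $T$ of a simplicial complex $\nabla$ has a free face $F$ if $F$ is a facet (maximal proper face) of $T$ and $F$ is a face of no other $m$-simplex of $\nabla$. Passing from $\nabla$ to the subcomplex $\nabla\setminus\{T,F\}$ is an elementary collapse. $\nabla$ collapses to $\Delta$ if $\Delta$ is obtained from $\nabla$ by a (finite) sequence of elementary collapses; $\nabla$ is collapsible if it collapses to the complex consisting of one of its vertices. $\mathbb{Z}$-maps and $\mathbb{Z}$-retracts: for rational polyhedra $P\subseteq[0,1]^n$, $Q\subseteq[0,1]^m$, a map $\eta\colon P\to Q$ is a $\mathbb{Z}$-map if there is a triangulation $\mathcal K$ of $P$ such that on every simplex $T\in\mathcal K$, $\eta$ coincides with an (affine) linear map with integer coefficients, i.e. $x\mapsto Mx+b$ with $M\in\mathbb{Z}^{m\times n}$, $b\in\mathbb{Z}^m$. A $\mathbb{Z}$-retraction of $P$ is a $\mathbb{Z}$-map $\sigma\colon P\to P$ with $\sigma\circ\sigma=\sigma$; the set $\sigma(P)$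 is then called a $\mathbb{Z}$-retract of $P$. Regularity: for a rational point $v\in\mathbb{R}^n$, $\operatorname{den}(v)$ is the least common denominator of the coordinates of $v$, and $\widetilde v=\operatorname{den}(v)(v,1)\in\mathbb{Z}^{n+1}$. A simplex $\operatorname{conv}(w_0,\dots,w_m)\subseteq[0,1]^n$ is regular if its vertices are rational and $\{\widetilde{w_0},\dots,\widetilde{w_m}\}$ can be extended to a basis of the free abelian group $\mathbb{Z}^{n+1}$. A triangulation is regular if all its simplexes are regular. It is strongly regular if it is regular and, for each of its maximal simplexes, the greatest common divisor of the denominators of the vertices of that simplex is $1$. *)

theory Defs
  imports "HOL-Analysis.Analysis"
begin

section \<open>Polyhedra and triangulations\<close>

text \<open>
  The cube $[0,1]^n$ is \<^term>\<open>cbox 0 1 :: (real^'n) set\<close> with $n$ the cardinality of \<^typ>\<open>'n\<close>.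
  The library's \<^const>\<open>polyhedron\<close> (an intersection of half-spaces) and \<^const>\<open>triangulation\<close>
  (not required to be closed under faces) are different notions from the ones used here.
\<close>

definition cube_polyhedron :: "(real^'n) set \<Rightarrow> bool" where
  "cube_polyhedron P \<longleftrightarrow>
     (\<exists>\<S>. finite \<S> \<and> (\<forall>S\<in>\<S>. (\<exists>m. m simplex S) \<and> S \<subseteq> cbox 0 1) \<and> P = \<Union>\<S>)"

definition rational_point :: "real^'n \<Rightarrow> bool" where
  "rational_point v \<longleftrightarrow> (\<forall>i. v $ i \<in> \<rat>)"

text \<open>For a simplex, the extreme points are exactly its vertices.\<close>

definition vertices :: "(real^'n) set \<Rightarrow> (real^'n) set" where
  "vertices S = {v. v extreme_point_of S}"

definition rational_cube_polyhedron :: "(real^'n) set \<Rightarrow> bool" where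
  "rational_cube_polyhedron P \<longleftrightarrow>
     (\<exists>\<S>. finite \<S> \<and>
          (\<forall>S\<in>\<S>. (\<exists>m. m simplex S) \<and> S \<subseteq> cbox 0 1 \<and> (\<forall>v\<in>vertices S. rational_point v)) \<and>
          P = \<Union>\<S>)"

definition triangulation_of :: "(real^'n) set set \<Rightarrow> (real^'n) set \<Rightarrow> bool" where
  "triangulation_of \<Delta> P \<longleftrightarrow> simplicial_complex \<Delta> \<and> \<Union>\<Delta> = P"

section \<open>Collapsibility\<close>

text \<open>
  A nonempty \<^const>\<open>simplicial_complex\<close> of the library contains the empty simplex, because the empty
  set is a face of every simplex. A facet is nonempty by definition, so a vertex has no free
  face, and the complex consisting of a single vertex \<open>v\<close> is \<open>{{}, {v}}\<close>.
\<close>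

definition free_face :: "(real^'n) set set \<Rightarrow> (real^'n) set \<Rightarrow> (real^'n) set \<Rightarrow> bool" where
  "free_face \<Gamma> T F \<longleftrightarrow>
     T \<in> \<Gamma> \<and> F facet_of T \<and>
     (\<exists>m. m simplex T \<and> (\<forall>T'\<in>\<Gamma>. m simplex T' \<and> F face_of T' \<longrightarrow> T' = T))"

definition elementary_collapse :: "(real^'n) set set \<Rightarrow> (real^'n) set set \<Rightarrow> bool" where
  "elementary_collapse \<Gamma> \<Delta> \<longleftrightarrow> (\<exists>T F. free_face \<Gamma> T F \<and> \<Delta> = \<Gamma> - {T, F})"

definition collapses_to :: "(real^'n) set set \<Rightarrow> (real^'n) set set \<Rightarrow> bool" where
  "collapses_to = elementary_collapse\<^sup>*\<^sup>*"

definition collapsible :: "(real^'n) set set \<Rightarrow> bool" where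
  "collapsible \<Gamma> \<longleftrightarrow> (\<exists>v. {v} \<in> \<Gamma> \<and> collapses_to \<Gamma> {{}, {v}})"

section \<open>$\mathbb{Z}$-maps and $\mathbb{Z}$-retracts\<close>

definition Z_map :: "(real^'n) set \<Rightarrow> (real^'m) set \<Rightarrow> (real^'n \<Rightarrow> real^'m) \<Rightarrow> bool" where
  "Z_map P Q \<eta> \<longleftrightarrow>
     rational_cube_polyhedron P \<and> rational_cube_polyhedron Q \<and> \<eta> ` P \<subseteq> Q \<and>
     (\<exists>\<K>. triangulation_of \<K> P \<and>
        (\<forall>T\<in>\<K>. \<exists>(M :: real^'n^'m) (b :: real^'m).
           (\<forall>i j. M $ i $ j \<in> \<int>) \<and> (\<forall>i. b $ i \<in> \<int>) \<and> (\<forall>x\<in>T. \<eta> x = M *v x + b)))"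

definition Z_retraction :: "(real^'n) set \<Rightarrow> (real^'n \<Rightarrow> real^'n) \<Rightarrow> bool" where
  "Z_retraction P \<sigma> \<longleftrightarrow> Z_map P P \<sigma> \<and> (\<forall>x\<in>P. \<sigma> (\<sigma> x) = \<sigma> x)"

definition Z_retract :: "(real^'n) set \<Rightarrow> (real^'n) set \<Rightarrow> bool" where
  "Z_retract R P \<longleftrightarrow> (\<exists>\<sigma>. Z_retraction P \<sigma> \<and> R = \<sigma> ` P)"

section \<open>Regularity\<close>

text \<open>Least common denominator; only meaningful for a rational point.\<close>

definition den :: "real^'n \<Rightarrow> nat" where
  "den v = (LEAST d. d > 0 \<and> (\<forall>i. of_nat d * v $ i \<in> \<int>))"

text \<open>
  $\mathbb{Z}^{n+1}$ is \<^typ>\<open>int^('n option)\<close>: the index \<^term>\<open>Some i\<close> is the $i$-th coordinate and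
  \<^const>\<open>None\<close> the additional last one. For a rational point the floor is applied to an integer
  (lemma \<open>homogeneous_Some\<close> below).
\<close>

definition homogeneous :: "real^'n \<Rightarrow> int^('n option)" where
  "homogeneous v =
     (\<chi> k. case k of Some i \<Rightarrow> \<lfloor>of_nat (den v) * v $ i\<rfloor> | None \<Rightarrow> int (den v))"

interpretation int_vec: module "(*s) :: int \<Rightarrow> int^'k \<Rightarrow> int^'k"
  by standard (simp_all add: vec_eq_iff algebra_simps)

definition Z_basis :: "(int^'k) set \<Rightarrow> bool" where
  "Z_basis B \<longleftrightarrow> int_vec.independent B \<and> int_vec.span B = UNIV"

definition regular_simplex :: "(real^'n) set \<Rightarrow> bool" where
  "regular_simplex S \<longleftrightarrow>
     (\<exists>m. m simplex S) \<and> S \<subseteq> cbox 0 1 \<and> (\<forall>v\<in>vertices S. rational_point v) \<and>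
     (\<exists>B. Z_basis B \<and> homogeneous ` vertices S \<subseteq> B)"

definition regular :: "(real^'n) set set \<Rightarrow> bool" where
  "regular \<Delta> \<longleftrightarrow> (\<forall>S\<in>\<Delta>. regular_simplex S)"

definition maximal_simplex :: "(real^'n) set set \<Rightarrow> (real^'n) set \<Rightarrow> bool" where
  "maximal_simplex \<Delta> S \<longleftrightarrow> S \<in> \<Delta> \<and> (\<forall>S'\<in>\<Delta>. S \<subseteq> S' \<longrightarrow> S' = S)"

definition strongly_regular :: "(real^'n) set set \<Rightarrow> bool" where
  "strongly_regular \<Delta> \<longleftrightarrow>
     regular \<Delta> \<and> (\<forall>S. maximal_simplex \<Delta> S \<longrightarrow> Gcd (den ` vertices S) = 1)"

lemma den_works:
  assumes "rational_point (v :: real^'n)"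
  shows "den v > 0" "of_nat (den v) * v $ i \<in> \<int>"
proof -
  have "\<exists>d::nat. d > 0 \<and> of_nat d * v $ i \<in> \<int>" for i
  proof -
    obtain a b :: int where ab: "b > 0" "v $ i = of_int a / of_int b"
      using assms unfolding rational_point_def by (metis Rats_cases')
    have "of_nat (nat b) * v $ i = of_int a" using ab by simp
    then show ?thesis using ab(1) by (intro exI[of _ "nat b"]) auto
  qed
  then obtain f :: "'n \<Rightarrow> nat" where f: "\<And>i. f i > 0 \<and> of_nat (f i) * v $ i \<in> \<int>"
    by metis
  let ?d = "\<Prod>i\<in>UNIV. f i"
  have "of_nat ?d * v $ i \<in> \<int>" for i
  proof -
    have "?d = (\<Prod>j\<in>UNIV - {i}. f j) * f i"
      by (subst prod.remove[of UNIV i]) (auto simp: mult.commute)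
    then have "of_nat ?d * v $ i = of_nat (\<Prod>j\<in>UNIV - {i}. f j) * (of_nat (f i) * v $ i)"
      by (simp only: of_nat_mult mult.assoc)
    then show ?thesis using f[of i] by (metis Ints_mult Ints_of_nat)
  qed
  moreover have "?d > 0" using f by (simp add: prod_pos)
  ultimately have "\<exists>d. d > 0 \<and> (\<forall>i. of_nat d * v $ i \<in> \<int>)" by blast
  then have "den v > 0 \<and> (\<forall>i. of_nat (den v) * v $ i \<in> \<int>)"
    unfolding den_def by (rule LeastI_ex)
  then show "den v > 0" "of_nat (den v) * v $ i \<in> \<int>" by auto
qed

lemma homogeneous_Some:
  assumes "rational_point v"
  shows "of_int (homogeneous v $ Some i) = of_nat (den v) * v $ i"
  using den_works(2)[OF assms, of i] by (simp add: homogeneous_def)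

end

theory Submission
  imports Defs
begin

text \<open>
  By the library's theory of absolute retracts, \<open>P\<close> is one, since an elementary expansion glues a
  simplex along a starlike union of facets; so there is a continuous retraction \<open>\<phi>\<close> of the cube
  onto \<open>P\<close>, which can be chosen to send the finitely many points of small denominator outside
  \<open>P\<close> to the given vertex of the cube. At any other point outside \<open>P\<close> the values of integer affine
  functions are nearly dense in the reals, so a Stone--Weierstrass argument in the lattice of
  integer piecewise linear functions makes \<open>\<phi>\<close> into a \<open>\<int>\<close>-map of the cube to a small
  neighbourhood of \<open>P\<close> that still fixes \<open>P\<close>.

  Strong regularity provides a \<open>\<int>\<close>-retraction of a neighbourhood of \<open>P\<close> onto \<open>P\<close>. Extend the
  hats of the triangulation to the whole space. Near \<open>P\<close> they violate the relations that hold on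
  \<open>P\<close> by some small \<open>c\<close>. Subtracting a multiple of \<open>c\<close> gives supports that are simplexes, but loses
  some mass, which has to be put back with integer coefficients. On a simplex whose denominators
  have a common divisor this is possible only modulo that divisor. The comparison of the hats with
  \<open>c\<close> defines a flag of simplexes, and along the flag one puts back as much as possible on each
  simplex in turn; where this overshoots, the excess is compensated, up to multiples of a common
  modulus, in a maximal simplex containing the current one, where the greatest common divisor is 1.
  The multiples of the modulus are finally taken from a large hat.
\<close>

section \<open>Integer piecewise linear functions\<close>

text \<open>The obstacle throughout is that a function built from integer affine ones can only take
  integer multiples of \<open>1 / d\<close> as values at a point of denominator \<open>d\<close>. In
  the approximation this is why points of small denominator are set aside: the integral coordinates
  of a vertex of the cube are values that are available at every point. In the neighbourhood
  retraction it rules out the usual normalisation, since coordinates cannot be divided by their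
  total mass; mass can only be moved in integer multiples of the quantities at hand. Therefore every
  correction is kept below a constant multiple of \<open>c\<close>. On \<open>P\<close> one has
  \<open>c = 0\<close>, so all corrections vanish there. Near \<open>P\<close> they are dwarfed by
  the largest hat, which stays away from zero as \<open>c\<close> tends to zero; this makes the
  final repayment possible.\<close>

text \<open>Generating these functions by lattice operations, rather than describing them piece by
  piece, makes them defined on the whole space and closed under composition.\<close>

inductive zpl :: "(real^'n \<Rightarrow> real) \<Rightarrow> bool" where
  zpl_const: "zpl (\<lambda>x. of_int k)"
| zpl_coord: "zpl (\<lambda>x. x $ i)"
| zpl_add: "zpl f \<Longrightarrow> zpl g \<Longrightarrow> zpl (\<lambda>x. f x + g x)"
| zpl_minus: "zpl f \<Longrightarrow> zpl (\<lambda>x. - f x)"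
| zpl_max: "zpl f \<Longrightarrow> zpl g \<Longrightarrow> zpl (\<lambda>x. max (f x) (g x))"

lemma zpl_0: "zpl (\<lambda>x. 0)" and zpl_1: "zpl (\<lambda>x. 1)"
  using zpl_const[of 0] zpl_const[of 1] by auto

lemma zpl_Ints: "r \<in> \<int> \<Longrightarrow> zpl (\<lambda>x. r)"
  by (elim Ints_cases) (simp add: zpl_const)

lemma zpl_diff: "zpl f \<Longrightarrow> zpl g \<Longrightarrow> zpl (\<lambda>x. f x - g x)"
  using zpl_add[OF _ zpl_minus, of f g] by simp

lemma zpl_min: "zpl f \<Longrightarrow> zpl g \<Longrightarrow> zpl (\<lambda>x. min (f x) (g x))"
  using zpl_minus[OF zpl_max[OF zpl_minus zpl_minus, of f g]] by (simp add: minus_max_eq_min)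

lemma zpl_abs: "zpl f \<Longrightarrow> zpl (\<lambda>x. \<bar>f x\<bar>)"
proof -
  have "\<bar>r\<bar> = max r (- r)" for r :: real by auto
  then show "zpl f \<Longrightarrow> zpl (\<lambda>x. \<bar>f x\<bar>)"
    using zpl_max[OF _ zpl_minus, of f f] by simp
qed

lemma zpl_sum: "(\<And>i. i \<in> A \<Longrightarrow> zpl (f i)) \<Longrightarrow> zpl (\<lambda>x. \<Sum>i\<in>A. f i x)"
  by (induction A rule: infinite_finite_induct) (auto simp: zpl_0 intro: zpl_add)

lemma zpl_of_nat_mult: "zpl f \<Longrightarrow> zpl (\<lambda>x. of_nat m * f x)"
  by (induction m) (auto simp: zpl_0 algebra_simps intro: zpl_add)

lemma zpl_of_int_mult:
  assumes "zpl f" shows "zpl (\<lambda>x. of_int m * f x)"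
  using zpl_of_nat_mult[OF assms, of "nat m"] zpl_minus[OF zpl_of_nat_mult[OF assms, of "nat (- m)"]]
  by (cases "m \<ge> 0") auto

lemma zpl_Ints_mult: "r \<in> \<int> \<Longrightarrow> zpl f \<Longrightarrow> zpl (\<lambda>x. r * f x)"
  by (elim Ints_cases) (simp add: zpl_of_int_mult)

lemma zpl_if: "(b \<Longrightarrow> zpl f) \<Longrightarrow> (\<not> b \<Longrightarrow> zpl g) \<Longrightarrow> zpl (\<lambda>x. if b then f x else g x)"
  by (cases b) auto

lemma zpl_Min:
  assumes "finite A" "A \<noteq> {}" "\<And>i. i \<in> A \<Longrightarrow> zpl (f i)"
  shows "zpl (\<lambda>x. Min ((\<lambda>i. f i x) ` A))"
  using assms by (induction A rule: finite_ne_induct) (auto intro: zpl_min)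

lemma zpl_Max:
  assumes "finite A" "A \<noteq> {}" "\<And>i. i \<in> A \<Longrightarrow> zpl (f i)"
  shows "zpl (\<lambda>x. Max ((\<lambda>i. f i x) ` A))"
  using assms by (induction A rule: finite_ne_induct) (auto intro: zpl_max)

lemma zpl_compose:
  fixes r :: "real^'n \<Rightarrow> real^'m"
  assumes "zpl f" "\<And>i. zpl (\<lambda>x. r x $ i)"
  shows "zpl (\<lambda>x. f (r x))"
  using assms(1) by induction (auto intro: zpl.intros assms(2))

lemma continuous_zpl: "zpl f \<Longrightarrow> continuous_on S f"
  by (induction rule: zpl.induct) (auto intro: continuous_on_const continuous_on_add continuous_on_minus continuous_on_max
      continuous_on_component[OF continuous_on_id])

section \<open>Affine pieces and polyhedral subdivisions\<close>

definition int_affine :: "(real^'n \<Rightarrow> real) \<Rightarrow> bool" where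
  "int_affine l \<longleftrightarrow> (\<exists>m k. (\<forall>i. m $ i \<in> \<int>) \<and> k \<in> \<int> \<and> l = (\<lambda>x. m \<bullet> x + k))"

lemma zpl_int_affine: "int_affine l \<Longrightarrow> zpl l"
  unfolding int_affine_def inner_vec_def
  by (auto intro!: zpl_add zpl_Ints zpl_sum zpl_Ints_mult zpl_coord)

lemma int_affine_diff: "int_affine l \<Longrightarrow> int_affine l' \<Longrightarrow> int_affine (\<lambda>x. l x - l' x)"
  unfolding int_affine_def
proof (elim exE conjE)
  fix m k m' k' assume a: "\<forall>i. m $ i \<in> \<int>" "k \<in> \<int>" "l = (\<lambda>x. m \<bullet> x + k)"
    "\<forall>i. m' $ i \<in> \<int>" "k' \<in> \<int>" "l' = (\<lambda>x. m' \<bullet> x + k')"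
  show "\<exists>m k. (\<forall>i. m $ i \<in> \<int>) \<and> k \<in> \<int> \<and> (\<lambda>x. l x - l' x) = (\<lambda>x. m \<bullet> x + k)"
    using a by (intro exI[of _ "m - m'"] exI[of _ "k - k'"]) (auto simp: inner_diff_left)
qed

lemma int_affine_minus: "int_affine l \<Longrightarrow> int_affine (\<lambda>x. - l x)"
  using int_affine_diff[of "\<lambda>x. 0" l] by (force simp: int_affine_def intro: exI[of _ 0])

lemma int_affine_add: "int_affine l \<Longrightarrow> int_affine l' \<Longrightarrow> int_affine (\<lambda>x. l x + l' x)"
  using int_affine_diff[OF _ int_affine_minus, of l l'] by simp

lemma int_affine_of_int_mult:
  assumes "int_affine l" shows "int_affine (\<lambda>x. of_int k * l x)"
proof -
  obtain m c where "\<forall>i. m $ i \<in> \<int>" "c \<in> \<int>" "l = (\<lambda>x. m \<bullet> x + c)"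
    using assms unfolding int_affine_def by blast
  then show ?thesis unfolding int_affine_def
    by (intro exI[of _ "of_int k *\<^sub>R m"] exI[of _ "of_int k * c"]) (auto simp: algebra_simps)
qed

lemma int_affine_const: "int_affine (\<lambda>x. 1)"
  unfolding int_affine_def by (intro exI[of _ 0] exI[of _ 1]) auto

lemma int_affine_coord: "int_affine (\<lambda>x. x $ i)"
  unfolding int_affine_def
proof (intro exI[of _ "axis i 1"] exI[of _ 0] conjI)
  show "\<forall>j. axis i 1 $ j \<in> (\<int> :: real set)" by (simp add: axis_def)
qed (simp_all add: inner_axis')

definition one_sided :: "((real^'n) \<times> real) set \<Rightarrow> (real^'n) set \<Rightarrow> bool" where
  "one_sided I C \<longleftrightarrow> (\<forall>(a, b)\<in>I. (\<forall>x\<in>C. a \<bullet> x \<le> b) \<or> (\<forall>x\<in>C. a \<bullet> x \<ge> b))"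

lemma one_sided_mono: "one_sided I C \<Longrightarrow> J \<subseteq> I \<Longrightarrow> D \<subseteq> C \<Longrightarrow> one_sided J D"
  unfolding one_sided_def by blast

text \<open>Finiteness of \<open>L\<close> keeps the induction over \<open>zpl\<close> going: a
  maximum needs the hyperplanes where two candidate pieces agree, for all pairs of pieces.
  Quantifying over arbitrary one-sided sets lets the hyperplanes of several functions be united
  freely.\<close>

definition pieces where
  "pieces f I L \<longleftrightarrow> finite I \<and> finite L \<and> (\<forall>l\<in>L. int_affine l) \<and>
     (\<forall>C. one_sided I C \<longrightarrow> (\<exists>l\<in>L. \<forall>x\<in>C. f x = l x))"

lemma zpl_pieces:
  assumes "zpl f"
  shows "\<exists>I L. pieces f I L"
  using assms
proof induction
  case (zpl_const k)
  have "int_affine (\<lambda>x::real^'a. of_int k)"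
    unfolding int_affine_def by (intro exI[of _ 0] exI[of _ "of_int k"]) auto
  then show ?case by (unfold pieces_def, intro exI[of _ "{}"] exI[of _ "{\<lambda>x. of_int k}"]) auto
next
  case (zpl_coord i)
  show ?case
    by (unfold pieces_def, intro exI[of _ "{}"] exI[of _ "{\<lambda>x. x $ i}"]) (auto simp: int_affine_coord)
next
  case (zpl_add f g)
  then obtain I L J M where "pieces f I L" "pieces g J M" by blast
  then have I: "finite I" "finite L" "\<forall>l\<in>L. int_affine l"
      "\<And>C. one_sided I C \<Longrightarrow> \<exists>l\<in>L. \<forall>x\<in>C. f x = l x"
    and J: "finite J" "finite M" "\<forall>l\<in>M. int_affine l"
      "\<And>C. one_sided J C \<Longrightarrow> \<exists>l\<in>M. \<forall>x\<in>C. g x = l x"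
    unfolding pieces_def by simp_all
  let ?N = "(\<lambda>(l, m). \<lambda>x. l x + m x) ` (L \<times> M)"
  have "\<exists>l\<in>?N. \<forall>x\<in>C. f x + g x = l x" if C: "one_sided (I \<union> J) C" for C
  proof -
    have "one_sided I C" "one_sided J C" using one_sided_mono[OF C] by auto
    with I(4) J(4) obtain l m where "l \<in> L" "\<forall>x\<in>C. f x = l x" "m \<in> M" "\<forall>x\<in>C. g x = m x" by meson
    then show ?thesis by (intro bexI[of _ "\<lambda>x. l x + m x"]) auto
  qed
  then show ?case
    using I J by (unfold pieces_def, intro exI[of _ "I \<union> J"] exI[of _ ?N]) (auto intro: int_affine_add)
next
  case (zpl_minus f)
  then obtain I L where "pieces f I L" by blast
  then have I: "finite I" "finite L" "\<forall>l\<in>L. int_affine l"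
      "\<And>C. one_sided I C \<Longrightarrow> \<exists>l\<in>L. \<forall>x\<in>C. f x = l x"
    unfolding pieces_def by simp_all
  let ?N = "(\<lambda>l. \<lambda>x. - l x) ` L"
  have "\<exists>l\<in>?N. \<forall>x\<in>C. - f x = l x" if C: "one_sided I C" for C
    using I(4)[OF C] by auto
  then show ?case
    using I by (unfold pieces_def, intro exI[of _ I] exI[of _ ?N]) (auto intro: int_affine_minus)
next
  case (zpl_max f g)
  then obtain I L J M where "pieces f I L" "pieces g J M" by blast
  then have I: "finite I" "finite L" "\<forall>l\<in>L. int_affine l"
      "\<And>C. one_sided I C \<Longrightarrow> \<exists>l\<in>L. \<forall>x\<in>C. f x = l x"
    and J: "finite J" "finite M" "\<forall>l\<in>M. int_affine l"
      "\<And>C. one_sided J C \<Longrightarrow> \<exists>l\<in>M. \<forall>x\<in>C. g x = l x"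
    unfolding pieces_def by simp_all
  have "\<exists>a b. \<forall>x. (a \<bullet> x \<le> b \<longleftrightarrow> l x \<le> m x) \<and> (a \<bullet> x \<ge> b \<longleftrightarrow> l x \<ge> m x)"
    if "l \<in> L" "m \<in> M" for l m
  proof -
    have "int_affine (\<lambda>x. l x - m x)" using that I(3) J(3) by (auto intro: int_affine_diff)
    then obtain a k where ak: "\<And>x. l x - m x = a \<bullet> x + k" unfolding int_affine_def by metis
    have "(a \<bullet> x \<le> -k \<longleftrightarrow> l x \<le> m x) \<and> (a \<bullet> x \<ge> -k \<longleftrightarrow> l x \<ge> m x)" for x
      using ak[of x] by auto
    then show "\<exists>a b. \<forall>x. (a \<bullet> x \<le> b \<longleftrightarrow> l x \<le> m x) \<and> (a \<bullet> x \<ge> b \<longleftrightarrow> l x \<ge> m x)"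
      by metis
  qed
  then obtain A B where AB: "\<And>l m x. l \<in> L \<Longrightarrow> m \<in> M \<Longrightarrow>
      (A l m \<bullet> x \<le> B l m \<longleftrightarrow> l x \<le> m x) \<and> (A l m \<bullet> x \<ge> B l m \<longleftrightarrow> l x \<ge> m x)"
    by metis
  let ?K = "I \<union> J \<union> (\<lambda>(l, m). (A l m, B l m)) ` (L \<times> M)"
  have "\<exists>l\<in>L \<union> M. \<forall>x\<in>C. max (f x) (g x) = l x" if C: "one_sided ?K C" for C
  proof -
    have "one_sided I C" "one_sided J C" using one_sided_mono[OF C] by auto
    with I(4) J(4) obtain l m where lm: "l \<in> L" "\<forall>x\<in>C. f x = l x" "m \<in> M" "\<forall>x\<in>C. g x = m x" by meson
    have "(\<forall>x\<in>C. A l m \<bullet> x \<le> B l m) \<or> (\<forall>x\<in>C. A l m \<bullet> x \<ge> B l m)"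
      using C lm unfolding one_sided_def by fast
    then have "(\<forall>x\<in>C. l x \<le> m x) \<or> (\<forall>x\<in>C. l x \<ge> m x)" using AB lm by blast
    then show ?thesis
    proof
      assume "\<forall>x\<in>C. l x \<le> m x"
      with lm show ?thesis by (intro bexI[of _ m]) (auto simp: max_def)
    next
      assume "\<forall>x\<in>C. l x \<ge> m x"
      with lm show ?thesis by (intro bexI[of _ l]) (auto simp: max_def)
    qed
  qed
  then show ?case
    using I J by (unfold pieces_def, intro exI[of _ ?K] exI[of _ "L \<union> M"]) auto
qed

text \<open>The cube is cut along the hyperplanes that \<open>pieces\<close> provides for all
  members of \<open>F\<close> together.\<close>

lemma zpl_cell_complex:
  fixes F :: "(real^'n \<Rightarrow> real) set"
  assumes "finite F" "\<forall>f\<in>F. zpl f"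
  obtains G where "\<Union>G = cbox 0 (1::real^'n)" "finite G" "\<forall>X\<in>G. polytope X"
    "\<forall>X\<in>G. \<forall>Y\<in>G. X \<inter> Y face_of X"
    "\<forall>X\<in>G. \<forall>f\<in>F. \<exists>l. int_affine l \<and> (\<forall>x\<in>X. f x = l x)"
proof -
  have "\<forall>f\<in>F. \<exists>I. finite I \<and> (\<forall>C. one_sided I C \<longrightarrow> (\<exists>l. int_affine l \<and> (\<forall>x\<in>C. f x = l x)))"
  proof
    fix f assume "f \<in> F"
    then obtain I L where "pieces f I L" using zpl_pieces assms(2) by blast
    then show "\<exists>I. finite I \<and> (\<forall>C. one_sided I C \<longrightarrow> (\<exists>l. int_affine l \<and> (\<forall>x\<in>C. f x = l x)))"
      unfolding pieces_def by (intro exI[of _ I] conjI allI impI) (simp, metis)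
  qed
  from bchoice[OF this] obtain I where I: "\<And>f. f \<in> F \<Longrightarrow> finite (I f)"
    "\<And>f C. f \<in> F \<Longrightarrow> one_sided (I f) C \<Longrightarrow> \<exists>l. int_affine l \<and> (\<forall>x\<in>C. f x = l x)" by blast
  let ?I = "\<Union>(I ` F)"
  have fin: "finite ?I" using I(1) assms(1) by auto
  have "\<exists>G. \<Union>G = \<Union>{cbox 0 (1::real^'n)} \<and> finite G \<and>
                 (\<forall>C \<in> G. \<exists>D. D \<in> {cbox 0 (1::real^'n)} \<and> C \<subseteq> D) \<and>
                 (\<forall>C \<in> {cbox 0 (1::real^'n)}. \<forall>x \<in> C. \<exists>D. D \<in> G \<and> x \<in> D \<and> D \<subseteq> C) \<and>
                 (\<forall>X \<in> G. polytope X) \<and>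
                 (\<forall>X \<in> G. aff_dim X \<le> aff_dim (cbox 0 (1::real^'n))) \<and>
                 (\<forall>X \<in> G. \<forall>Y \<in> G. X \<inter> Y face_of X) \<and>
                 (\<forall>X \<in> G. \<forall>x \<in> X. \<forall>y \<in> X. \<forall>a b.
                          (a,b) \<in> ?I \<longrightarrow> a \<bullet> x \<le> b \<and> a \<bullet> y \<le> b \<or> a \<bullet> x \<ge> b \<and> a \<bullet> y \<ge> b)"
    by (rule cell_subdivision_lemma[OF _ _ _ _ fin]) (auto simp: polytope_interval intro: face_of_refl)
  then obtain G where G: "\<Union>G = cbox 0 (1::real^'n)" "finite G" "\<forall>X\<in>G. polytope X"
     "\<forall>X\<in>G. \<forall>Y\<in>G. X \<inter> Y face_of X"
     "\<And>X x y a b. X \<in> G \<Longrightarrow> x \<in> X \<Longrightarrow> y \<in> X \<Longrightarrow> (a,b) \<in> ?I \<Longrightarrow>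
        a \<bullet> x \<le> b \<and> a \<bullet> y \<le> b \<or> a \<bullet> x \<ge> b \<and> a \<bullet> y \<ge> b"
    by auto
  \<comment> \<open>The subdivision compares the points of a cell in pairs; a cell with points
    strictly on both sides of a hyperplane would contain a forbidden pair.\<close>
  have "one_sided ?I X" if "X \<in> G" for X
    unfolding one_sided_def
  proof (rule ballI, rule prod.case_eq_if[THEN iffD2])
    fix h assume h: "h \<in> ?I"
    show "(\<forall>x\<in>X. fst h \<bullet> x \<le> snd h) \<or> (\<forall>x\<in>X. snd h \<le> fst h \<bullet> x)"
    proof (rule ccontr)
      assume "\<not> ?thesis"
      then obtain x y where "x \<in> X" "\<not> fst h \<bullet> x \<le> snd h" "y \<in> X" "\<not> snd h \<le> fst h \<bullet> y" by blast
      then show False using G(5)[OF that, of x y "fst h" "snd h"] h by auto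
    qed
  qed
  then have "\<exists>l. int_affine l \<and> (\<forall>x\<in>X. f x = l x)" if "X \<in> G" "f \<in> F" for X f
    using I(2)[OF that(2)] one_sided_mono[of ?I X "I f" X] that by blast
  then show ?thesis using that[of G] G by blast
qed

lemma zpl_triangulation:
  fixes F :: "(real^'n \<Rightarrow> real) set"
  assumes "finite F" "\<forall>f\<in>F. zpl f"
  obtains K where "triangulation_of K (cbox 0 1)"
    "\<forall>X\<in>K. \<forall>f\<in>F. \<exists>l. int_affine l \<and> (\<forall>x\<in>X. f x = l x)"
proof -
  obtain G where G: "\<Union>G = cbox 0 (1::real^'n)" "finite G" "\<forall>X\<in>G. polytope X"
    "\<forall>X\<in>G. \<forall>Y\<in>G. X \<inter> Y face_of X"
    "\<forall>X\<in>G. \<forall>f\<in>F. \<exists>l. int_affine l \<and> (\<forall>x\<in>X. f x = l x)"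
    using zpl_cell_complex[OF assms] by metis
  obtain T where T: "simplicial_complex T" "\<Union>T = \<Union>G" "\<And>K. K \<in> T \<Longrightarrow> \<exists>C. C \<in> G \<and> K \<subseteq> C"
    by (rule simplicial_subdivision_of_cell_complex[of G]) (use G in auto)
  show ?thesis
  proof
    show "triangulation_of T (cbox 0 1)" using T G(1) by (simp add: triangulation_of_def)
    show "\<forall>X\<in>T. \<forall>f\<in>F. \<exists>l. int_affine l \<and> (\<forall>x\<in>X. f x = l x)"
      using T(3) G(5) by (meson subsetD)
  qed
qed

section \<open>A Lojasiewicz inequality and gluing\<close>

text \<open>On a cell where both absolute values are affine, the inequality has to be checked only
  at finitely many generators. There it is a matter of choosing \<open>m\<close>, because a zero of
  \<open>u\<close> is a zero of \<open>w\<close>.\<close>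

lemma zpl_Lojasiewicz:
  fixes u w :: "real^'n \<Rightarrow> real"
  assumes u: "zpl u" and w: "zpl w" and zero: "\<And>x. x \<in> cbox 0 1 \<Longrightarrow> u x = 0 \<Longrightarrow> w x = 0"
  obtains m :: nat where "\<And>x. x \<in> cbox 0 1 \<Longrightarrow> \<bar>w x\<bar> \<le> real m * \<bar>u x\<bar>"
proof -
  obtain G where G: "\<Union>G = cbox 0 (1::real^'n)" "finite G" "\<forall>X\<in>G. polytope X"
    "\<forall>X\<in>G. \<forall>f\<in>{\<lambda>x. \<bar>u x\<bar>, \<lambda>x. \<bar>w x\<bar>}. \<exists>l. int_affine l \<and> (\<forall>x\<in>X. f x = l x)"
    by (rule zpl_cell_complex[of "{\<lambda>x. \<bar>u x\<bar>, \<lambda>x. \<bar>w x\<bar>}"]) (use zpl_abs[OF u] zpl_abs[OF w] in simp_all)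
  have "\<exists>m::nat. \<forall>x\<in>X. \<bar>w x\<bar> \<le> real m * \<bar>u x\<bar>" if X: "X \<in> G" for X
  proof -
    have sub: "X \<subseteq> cbox 0 1" using G(1) X by auto
    obtain E where E: "finite E" "X = convex hull E" using G(3) X unfolding polytope_def by blast
    have EX: "E \<subseteq> X" unfolding E(2) by (rule hull_subset)
    obtain l where l: "int_affine l" "\<forall>x\<in>X. \<bar>u x\<bar> = l x"
      using bspec[OF bspec[OF G(4) X], of "\<lambda>x. \<bar>u x\<bar>"] by blast
    obtain l' where l': "int_affine l'" "\<forall>x\<in>X. \<bar>w x\<bar> = l' x"
      using bspec[OF bspec[OF G(4) X], of "\<lambda>x. \<bar>w x\<bar>"] by blast
    have "\<exists>m::nat. \<bar>w x\<bar> \<le> real m * \<bar>u x\<bar>" if "x \<in> E" for x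
    proof (cases "u x = 0")
      case True
      then show ?thesis using zero that EX sub by force
    next
      case False
      then obtain m :: nat where "\<bar>w x\<bar> < real m * \<bar>u x\<bar>" using ex_less_of_nat_mult[of "\<bar>u x\<bar>"] by auto
      then show ?thesis by (intro exI[of _ m]) auto
    qed
    then obtain m where m: "\<And>x. x \<in> E \<Longrightarrow> \<bar>w x\<bar> \<le> real (m x) * \<bar>u x\<bar>" by metis
    define M where "M = (\<Sum>x\<in>E. m x)"
    have M: "\<bar>w x\<bar> \<le> real M * \<bar>u x\<bar>" if "x \<in> E" for x
    proof -
      have "m x \<le> M" unfolding M_def using E(1) that by (simp add: member_le_sum)
      then have "real (m x) * \<bar>u x\<bar> \<le> real M * \<bar>u x\<bar>" by (intro mult_right_mono) auto
      with m[OF that] show ?thesis by linarith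
    qed
    obtain a k where a: "l = (\<lambda>x. a \<bullet> x + k)" using l(1) unfolding int_affine_def by blast
    obtain a' k' where a': "l' = (\<lambda>x. a' \<bullet> x + k')" using l'(1) unfolding int_affine_def by blast
    let ?H = "{x. (a' - real M *\<^sub>R a) \<bullet> x \<le> real M * k - k'}"
    have H: "x \<in> ?H \<longleftrightarrow> l' x \<le> real M * l x" for x
      unfolding a a' by (auto simp: inner_diff_left algebra_simps)
    have "E \<subseteq> ?H"
    proof
      fix x assume "x \<in> E"
      then have "\<bar>w x\<bar> \<le> real M * \<bar>u x\<bar>" "x \<in> X" using M EX by auto
      then show "x \<in> ?H" using H l(2) l'(2) by simp
    qed
    then have "X \<subseteq> ?H" unfolding E(2) by (intro hull_minimal convex_halfspace_le)
    show ?thesis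
    proof (intro exI[of _ M] ballI)
      fix x assume x: "x \<in> X"
      then have "x \<in> ?H" using \<open>X \<subseteq> ?H\<close> by blast
      then show "\<bar>w x\<bar> \<le> real M * \<bar>u x\<bar>" using H x l(2) l'(2) by simp
    qed
  qed
  then obtain m where m: "\<And>X x. X \<in> G \<Longrightarrow> x \<in> X \<Longrightarrow> \<bar>w x\<bar> \<le> real (m X) * \<bar>u x\<bar>" by metis
  define M where "M = (\<Sum>X\<in>G. m X)"
  show ?thesis
  proof
    fix x :: "real^'n" assume "x \<in> cbox 0 1"
    then obtain X where X: "X \<in> G" "x \<in> X" using G(1) by blast
    have "m X \<le> M" unfolding M_def using G(2) X by (simp add: member_le_sum)
    then have "real (m X) * \<bar>u x\<bar> \<le> real M * \<bar>u x\<bar>" by (intro mult_right_mono) auto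
    with m[OF X] show "\<bar>w x\<bar> \<le> real M * \<bar>u x\<bar>" by linarith
  qed
qed

text \<open>\<open>g\<close> is clamped into the band of radius \<open>m * a\<close> around
  \<open>f\<close>. Where \<open>a\<close> vanishes, the band is reduced to \<open>f\<close>; where
  \<open>b\<close> vanishes, the Lojasiewicz inequality for \<open>a + b\<close> says that
  \<open>g\<close> already lies in the band.\<close>

lemma zpl_glue:
  fixes f g a b :: "real^'n \<Rightarrow> real"
  assumes zpl: "zpl f" "zpl g" "zpl a" "zpl b" and nonneg: "\<And>x. a x \<ge> 0" "\<And>x. b x \<ge> 0"
    and eq: "\<And>x. x \<in> cbox 0 1 \<Longrightarrow> a x = 0 \<Longrightarrow> b x = 0 \<Longrightarrow> f x = g x"
  obtains h where "zpl h" "\<And>x. x \<in> cbox 0 1 \<Longrightarrow> a x = 0 \<Longrightarrow> h x = f x"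
    "\<And>x. x \<in> cbox 0 1 \<Longrightarrow> b x = 0 \<Longrightarrow> h x = g x"
proof -
  obtain m :: nat where m: "\<And>x. x \<in> cbox 0 1 \<Longrightarrow> \<bar>f x - g x\<bar> \<le> real m * \<bar>a x + b x\<bar>"
    by (rule zpl_Lojasiewicz[of "\<lambda>x. a x + b x" "\<lambda>x. f x - g x"])
      (use zpl nonneg eq in \<open>auto intro: zpl_add zpl_diff simp: add_nonneg_eq_0_iff\<close>)
  let ?h = "\<lambda>x. min (max (g x) (f x - real m * a x)) (f x + real m * a x)"
  show ?thesis
  proof
    show "zpl ?h" using zpl by (intro zpl_min zpl_max zpl_add zpl_diff zpl_of_nat_mult)
    show "?h x = f x" if "x \<in> cbox 0 1" "a x = 0" for x using that by simp
    show "?h x = g x" if "x \<in> cbox 0 1" "b x = 0" for x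
      using m[OF that(1)] that(2) nonneg[of x] by (auto simp: abs_le_iff min_def max_def)
  qed
qed

section \<open>Retracting a neighbourhood of a weighted complex\<close>

lemma real_of_nat_sum_list: "real (\<Sum>x\<leftarrow>xs. f x) = (\<Sum>x\<leftarrow>xs. real (f x))"
  by (induction xs) auto

lemma Gcd_bezout:
  fixes d :: "'a \<Rightarrow> nat"
  assumes "finite M"
  shows "\<exists>a :: 'a \<Rightarrow> int. (\<Sum>v\<in>M. a v * int (d v)) = int (Gcd (d ` M))"
  using assms
proof induction
  case (insert v M)
  then obtain a where a: "(\<Sum>v\<in>M. a v * int (d v)) = int (Gcd (d ` M))" by blast
  obtain s t where st: "s * int (d v) + t * int (Gcd (d ` M)) = gcd (int (d v)) (int (Gcd (d ` M)))"
    using bezout_int by blast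
  let ?a = "\<lambda>w. if w = v then s else t * a w"
  have "(\<Sum>w\<in>insert v M. ?a w * int (d w)) = s * int (d v) + (\<Sum>w\<in>M. ?a w * int (d w))"
    using insert by simp
  also have "(\<Sum>w\<in>M. ?a w * int (d w)) = t * (\<Sum>w\<in>M. a w * int (d w))"
    unfolding sum_distrib_left using insert(2) by (intro sum.cong) auto
  also have "s * int (d v) + \<dots> = int (Gcd (d ` insert v M))"
    using a st by (simp add: gcd_int_int_eq)
  finally show ?case by (rule exI[of _ ?a])
qed auto

text \<open>\<open>d v\<close> stands for the denominator of the vertex \<open>v\<close>. The point with scaled barycentric
  coordinates \<open>y\<close>, where \<open>\<Sum>v\<in>V. d v * y v = 1\<close>, belongs to the complex if \<open>y\<close> is nonnegative and
  supported on a member of \<open>K\<close>.\<close>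

locale weighted_complex =
  fixes V :: "'a set" and K :: "'a set set" and d :: "'a \<Rightarrow> nat"
  assumes finite_V: "finite V" and K_sub: "S \<in> K \<Longrightarrow> S \<subseteq> V"
    and K_down: "S \<in> K \<Longrightarrow> T \<subseteq> S \<Longrightarrow> T \<in> K" and empty_K: "{} \<in> K"
    and d_pos: "v \<in> V \<Longrightarrow> d v > 0"
    and gcd1: "S \<in> K \<Longrightarrow> \<exists>M\<in>K. S \<subseteq> M \<and> Gcd (d ` M) = 1"
begin

section \<open>Placing mass with integer coefficients\<close>

text \<open>A common multiple of the weights, so that the mass \<open>modulus\<close> can be removed
  at any single vertex with an integer coefficient.\<close>

definition modulus :: nat where "modulus = (\<Prod>v\<in>V. d v)"

lemma modulus_pos: "modulus > 0"
  unfolding modulus_def using d_pos by (simp add: prod_pos)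

lemma dvd_modulus: "v \<in> V \<Longrightarrow> d v dvd modulus"
  unfolding modulus_def using finite_V by (rule dvd_prodI)

text \<open>Bezout on a set of gcd 1 containing \<open>S\<close> gives integers \<open>a v\<close>
  of weighted sum 1. Reducing \<open>- a v\<close> modulo \<open>modulus\<close> makes the
  coefficients nonnegative and changes the weighted sum -1 only by a multiple of
  \<open>modulus\<close>.\<close>

lemma ex_filler:
  assumes "S \<in> K"
  shows "\<exists>(b :: 'a \<Rightarrow> nat) n. S \<union> {v. b v \<noteq> 0} \<in> K \<and> (\<Sum>v\<in>V. d v * b v) + 1 = modulus * n"
proof -
  obtain M where M: "M \<in> K" "S \<subseteq> M" "Gcd (d ` M) = 1" using gcd1[OF assms] by blast
  have MV: "M \<subseteq> V" "finite M" using K_sub[OF M(1)] finite_V finite_subset by auto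
  obtain a :: "'a \<Rightarrow> int" where a: "(\<Sum>v\<in>M. a v * int (d v)) = 1"
    using Gcd_bezout[OF MV(2), of d] M(3) by auto
  define b where "b v = (if v \<in> M then nat ((- a v) mod int modulus) else 0)" for v
  have b: "int (b v) = (- a v) mod int modulus" if "v \<in> M" for v
    using that modulus_pos by (simp add: b_def)
  have "int ((\<Sum>v\<in>V. d v * b v) + 1) = (\<Sum>v\<in>M. int (d v) * int (b v)) + (\<Sum>v\<in>M. a v * int (d v))"
  proof -
    have "(\<Sum>v\<in>V. d v * b v) = (\<Sum>v\<in>M. d v * b v)"
      using finite_V MV by (intro sum.mono_neutral_right) (auto simp: b_def)
    then show ?thesis using a by simp
  qed
  also have "\<dots> = (\<Sum>v\<in>M. int (d v) * (int (b v) + a v))"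
    by (simp add: sum.distrib algebra_simps)
  also have "int modulus dvd \<dots>"
  proof (intro dvd_sum dvd_mult)
    fix v assume "v \<in> M"
    then show "int modulus dvd int (b v) + a v"
      by (simp add: b mod_eq_0_iff_dvd[symmetric] mod_simps)
  qed
  finally have "modulus dvd (\<Sum>v\<in>V. d v * b v) + 1" by presburger
  then obtain n where n: "(\<Sum>v\<in>V. d v * b v) + 1 = modulus * n" by blast
  have "S \<union> {v. b v \<noteq> 0} \<subseteq> M" using M(2) by (auto simp: b_def)
  then have "S \<union> {v. b v \<noteq> 0} \<in> K" using K_down M(1) by blast
  with n show ?thesis by blast
qed

text \<open>For \<open>S\<close> in \<open>K\<close> the filler has mass
  \<open>modulus * quota S - 1\<close>. Added \<open>e\<close> times to an overshoot
  \<open>e\<close>, it turns the latter into a surplus of \<open>quota S * e\<close> units of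
  \<open>modulus\<close>.\<close>

definition filler :: "'a set \<Rightarrow> 'a \<Rightarrow> nat" where
  "filler S = (SOME b. \<exists>n. S \<union> {v. b v \<noteq> 0} \<in> K \<and> (\<Sum>v\<in>V. d v * b v) + 1 = modulus * n)"

definition quota :: "'a set \<Rightarrow> nat" where
  "quota S = ((\<Sum>v\<in>V. d v * filler S v) + 1) div modulus"

lemma filler:
  assumes "S \<in> K"
  shows "S \<union> {v. filler S v \<noteq> 0} \<in> K"
    and "(\<Sum>v\<in>V. real (d v) * real (filler S v)) = real modulus * real (quota S) - 1"
proof -
  have "\<exists>n. S \<union> {v. filler S v \<noteq> 0} \<in> K \<and> (\<Sum>v\<in>V. d v * filler S v) + 1 = modulus * n"
    using someI_ex[OF ex_filler[OF assms]] unfolding filler_def .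
  then obtain n where n: "S \<union> {v. filler S v \<noteq> 0} \<in> K" "(\<Sum>v\<in>V. d v * filler S v) + 1 = modulus * n"
    by blast
  show "S \<union> {v. filler S v \<noteq> 0} \<in> K" by fact
  have "quota S = n" unfolding quota_def n(2) using modulus_pos by simp
  then have "real ((\<Sum>v\<in>V. d v * filler S v) + 1) = real (modulus * quota S)" using n(2) by simp
  then show "(\<Sum>v\<in>V. real (d v) * real (filler S v)) = real modulus * real (quota S) - 1" by simp
qed

definition mass :: "('a \<Rightarrow> real) \<Rightarrow> real" where
  "mass f = (\<Sum>v\<in>V. real (d v) * f v)"

definition supp :: "('a \<Rightarrow> real) \<Rightarrow> 'a set" where
  "supp f = {v \<in> V. f v > 0}"

definition wt :: "'a set \<Rightarrow> nat" where
  "wt S = (\<Sum>v\<in>S. d v)"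

text \<open>A state \<open>(f, t, r)\<close> consists of the coordinates assigned so far, the mass \<open>t\<close> that is still to
  be placed, and the surplus mass \<open>r\<close>, in units of \<^term>\<open>modulus\<close>, that has been placed in excess.
  The filler is only used when \<open>u < 0\<close>, and then nothing is left for the later simplexes; hence the
  support stays a simplex although the filler of \<open>S\<close> leaves \<open>S\<close>.\<close>

definition absorb :: "('a set \<Rightarrow> real) \<Rightarrow> 'a set \<Rightarrow> ('a \<Rightarrow> real) \<times> real \<times> real \<Rightarrow> ('a \<Rightarrow> real) \<times> real \<times> real" where
  "absorb X S = (\<lambda>(f, t, r).
     let x = min (X S) t; u = t - real (wt S) * x in
     (\<lambda>v. f v + (if v \<in> S then x else 0) + real (filler S v) * max 0 (- u),
      max 0 u, r + real (quota S) * max 0 (- u)))"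

text \<open>Hence raising all coordinates in \<open>S\<close> by \<open>t\<close> disposes of the
  mass \<open>t\<close> without a division by \<open>wt S\<close>, possibly with an
  overshoot.\<close>

lemma wt_ge_1: "S \<in> K \<Longrightarrow> S \<noteq> {} \<Longrightarrow> wt S \<ge> 1"
proof -
  assume S: "S \<in> K" "S \<noteq> {}"
  then obtain v where v: "v \<in> S" by blast
  have "d v \<le> wt S" unfolding wt_def
    using v finite_subset[OF K_sub finite_V, OF S(1)] by (simp add: member_le_sum)
  moreover have "d v > 0" using d_pos K_sub S v by blast
  ultimately show ?thesis by linarith
qed

text \<open>The first conclusion is the invariant of the procedure: an overshoot \<open>- u\<close>
  and its filler add up to mass \<open>modulus * quota S * (- u)\<close>, which is what the surplus
  records.\<close>

lemma absorb_step:
  assumes S: "S \<in> K" "S \<noteq> {}" and X: "X S \<ge> 0" and t: "t \<ge> 0"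
    and eq: "absorb X S (f, t, r) = (f', t', r')"
  shows "mass f' + t' - real modulus * r' = mass f + t - real modulus * r"
    and "0 \<le> t'" "t' \<le> t" "f v \<le> f' v" "r \<le> r'" "r' \<le> r + real (quota S * wt S) * t"
    and "X S \<ge> t \<Longrightarrow> t' = 0"
    and "t = 0 \<or> X S = 0 \<Longrightarrow> f' = f \<and> r' = r \<and> t' = t"
    and "supp f \<subseteq> S \<Longrightarrow> supp f' \<in> K \<and> (t' > 0 \<longrightarrow> supp f' \<subseteq> S)"
proof -
  define x where "x = min (X S) t"
  define u where "u = t - real (wt S) * x"
  have f': "f' = (\<lambda>v. f v + (if v \<in> S then x else 0) + real (filler S v) * max 0 (- u))"
    and t': "t' = max 0 u" and r': "r' = r + real (quota S) * max 0 (- u)"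
    using eq unfolding absorb_def x_def u_def by (auto simp: Let_def)
  have x: "0 \<le> x" "x \<le> t" using X t by (auto simp: x_def)
  have w: "real (wt S) \<ge> 1" using wt_ge_1[OF S] by simp
  have wx: "0 \<le> real (wt S) * x" "real (wt S) * x \<le> real (wt S) * t" "x \<le> real (wt S) * x"
    using x w mult_right_mono[OF w x(1)] by (auto intro: mult_left_mono)
  have "mass f' = mass f + real (wt S) * x + (real modulus * real (quota S) - 1) * max 0 (- u)"
  proof -
    have "(\<Sum>v\<in>V. real (d v) * (if v \<in> S then x else 0)) = (\<Sum>v\<in>S. real (d v) * x)"
      using finite_V K_sub[OF S(1)] by (intro sum.mono_neutral_cong_right) auto
    then have "(\<Sum>v\<in>V. real (d v) * (if v \<in> S then x else 0)) = real (wt S) * x"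
      by (simp add: wt_def sum_distrib_right)
    moreover have "(\<Sum>v\<in>V. real (d v) * (real (filler S v) * max 0 (- u)))
        = (real modulus * real (quota S) - 1) * max 0 (- u)"
      unfolding filler(2)[OF S(1), symmetric] by (simp add: sum_distrib_right mult.assoc)
    ultimately show ?thesis
      unfolding mass_def f' by (simp add: distrib_left sum.distrib)
  qed
  then show "mass f' + t' - real modulus * r' = mass f + t - real modulus * r"
  proof -
    have "max 0 u = u + max 0 (- u)" by auto
    with \<open>mass f' = _\<close> show ?thesis unfolding t' r' by (simp add: u_def algebra_simps)
  qed
  show "0 \<le> t'" "t' \<le> t" unfolding t' u_def using t wx by auto
  show "f v \<le> f' v" unfolding f' using x by auto
  show "r \<le> r'" unfolding r' by auto
  have "max 0 (- u) \<le> real (wt S) * t" unfolding u_def using wx t by auto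
  then have "real (quota S) * max 0 (- u) \<le> real (quota S) * (real (wt S) * t)"
    by (intro mult_left_mono) auto
  then show "r' \<le> r + real (quota S * wt S) * t" unfolding r' by (simp add: algebra_simps)
  show "t' = 0" if "X S \<ge> t"
    using that wx unfolding t' u_def x_def by auto
  show "f' = f \<and> r' = r \<and> t' = t" if "t = 0 \<or> X S = 0"
  proof -
    have "x = 0" using that X t by (auto simp: x_def)
    then show ?thesis using t unfolding f' r' t' u_def by auto
  qed
  show "supp f' \<in> K \<and> (t' > 0 \<longrightarrow> supp f' \<subseteq> S)" if "supp f \<subseteq> S"
  proof -
    have "supp f' \<subseteq> S \<union> {v. filler S v \<noteq> 0}"
      using that unfolding supp_def f' by (auto split: if_splits)
    then have "supp f' \<in> K" using filler(1)[OF S(1)] K_down by blast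
    moreover have "supp f' \<subseteq> S" if "t' > 0"
    proof -
      have "max 0 (- u) = 0" using that unfolding t' by auto
      then show ?thesis using \<open>supp f \<subseteq> S\<close> unfolding supp_def f' by (auto split: if_splits)
    qed
    ultimately show ?thesis by blast
  qed
qed

text \<open>The outstanding mass never increases, so a simplex with \<open>X S \<ge> t\<close> for
  the initial \<open>t\<close> still dominates it when its turn comes, and clears it.\<close>

lemma absorb_fold:
  assumes "\<And>S. S \<in> set Ss \<Longrightarrow> S \<in> K \<and> S \<noteq> {} \<and> X S \<ge> 0" and "t \<ge> 0"
    and "fold (absorb X) Ss (f, t, r) = (f', t', r')"
  shows "mass f' + t' - real modulus * r' = mass f + t - real modulus * r \<and>
    0 \<le> t' \<and> t' \<le> t \<and> (\<forall>v. f v \<le> f' v) \<and> r \<le> r' \<and>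
    r' \<le> r + (\<Sum>S\<leftarrow>Ss. real (quota S * wt S)) * t \<and>
    ((\<exists>S\<in>set Ss. X S \<ge> t) \<longrightarrow> t' = 0) \<and> (t = 0 \<longrightarrow> f' = f \<and> r' = r)"
  using assms
proof (induction Ss arbitrary: f t r)
  case (Cons S Ss)
  obtain f1 t1 r1 where 1: "absorb X S (f, t, r) = (f1, t1, r1)" by (metis prod_cases3)
  have S: "S \<in> K" "S \<noteq> {}" "X S \<ge> 0" using Cons.prems(1) by auto
  note st = absorb_step[of S X t f r f1 t1 r1, OF S Cons.prems(2) 1]
  have IH: "mass f' + t' - real modulus * r' = mass f1 + t1 - real modulus * r1 \<and>
    0 \<le> t' \<and> t' \<le> t1 \<and> (\<forall>v. f1 v \<le> f' v) \<and> r1 \<le> r' \<and>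
    r' \<le> r1 + (\<Sum>S\<leftarrow>Ss. real (quota S * wt S)) * t1 \<and>
    ((\<exists>S\<in>set Ss. X S \<ge> t1) \<longrightarrow> t' = 0) \<and> (t1 = 0 \<longrightarrow> f' = f1 \<and> r' = r1)"
    by (rule Cons.IH) (use Cons.prems st(2) 1 in auto)
  have "(\<Sum>S\<leftarrow>Ss. real (quota S * wt S)) * t1 \<le> (\<Sum>S\<leftarrow>Ss. real (quota S * wt S)) * t"
    using st(3) by (intro mult_left_mono sum_list_nonneg) auto
  then have "r' \<le> r + (\<Sum>S\<leftarrow>S # Ss. real (quota S * wt S)) * t"
    using IH st(6) by (simp add: algebra_simps)
  moreover have "t' = 0" if ex: "\<exists>T\<in>set (S # Ss). X T \<ge> t"
  proof (cases "X S \<ge> t")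
    case True then show ?thesis using st(7) IH by auto
  next
    case False
    then obtain T where "T \<in> set Ss" "X T \<ge> t" using ex by auto
    then show ?thesis using IH st(3) by (meson order_trans)
  qed
  moreover have "f' = f \<and> r' = r" if "t = 0" using st(8) IH that by auto
  moreover have "f v \<le> f' v" for v using st(4)[of v] IH order_trans by blast
  ultimately show ?case using IH st(1,3,5) by auto
qed auto

text \<open>The simplexes with positive \<open>X\<close> form a chain and are visited by increasing
  cardinality, hence in the order of inclusion, so the support stays inside those still to come.
  After the use of a filler \<open>t\<close> is 0 and the last assumption is vacuous.\<close>

lemma absorb_fold_supp:
  assumes "\<And>S. S \<in> set Ss \<Longrightarrow> S \<in> K \<and> S \<noteq> {} \<and> X S \<ge> 0" and "t \<ge> 0"
    and "fold (absorb X) Ss (f, t, r) = (f', t', r')"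
    and "sorted (map card Ss)"
    and "\<And>S T. S \<in> set Ss \<Longrightarrow> T \<in> set Ss \<Longrightarrow> X S > 0 \<Longrightarrow> X T > 0 \<Longrightarrow> S \<subseteq> T \<or> T \<subseteq> S"
    and "supp f \<in> K"
    and "\<And>S. S \<in> set Ss \<Longrightarrow> X S > 0 \<Longrightarrow> t > 0 \<Longrightarrow> supp f \<subseteq> S"
  shows "supp f' \<in> K"
  using assms
proof (induction Ss arbitrary: f t r)
  case (Cons S Ss)
  obtain f1 t1 r1 where 1: "absorb X S (f, t, r) = (f1, t1, r1)" by (metis prod_cases3)
  have S: "S \<in> K" "S \<noteq> {}" "X S \<ge> 0" using Cons.prems(1) by auto
  note st = absorb_step[of S X t f r f1 t1 r1, OF S Cons.prems(2) 1]
  show ?case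
  proof (rule Cons.IH[of t1 f1 r1])
    show "supp f1 \<in> K"
    proof (cases "t = 0 \<or> X S = 0")
      case True then show ?thesis using st(8) Cons.prems(6) by auto
    next
      case False
      then have "X S > 0" "t > 0" using S(3) Cons.prems(2) by auto
      then show ?thesis using st(9) Cons.prems(7)[of S] by auto
    qed
    show "supp f1 \<subseteq> T" if T: "T \<in> set Ss" "X T > 0" "t1 > 0" for T
    proof -
      have t: "t > 0" using st(3) T by auto
      show ?thesis
      proof (cases "X S = 0")
        case True then show ?thesis using st(8) Cons.prems(7)[of T] T t by auto
      next
        case False
        then have XS: "X S > 0" using S(3) by auto
        then have "supp f \<subseteq> S" using Cons.prems(7)[of S] t by auto
        then have "supp f1 \<subseteq> S" using st(9) T by auto
        moreover have "S \<subseteq> T"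
        proof -
          have "S \<subseteq> T \<or> T \<subseteq> S" using Cons.prems(5)[of S T] T XS by auto
          moreover have "card S \<le> card T" using Cons.prems(4) T by auto
          moreover have "finite S" using K_sub[OF S(1)] finite_V finite_subset by blast
          ultimately show ?thesis using card_seteq by blast
        qed
        ultimately show ?thesis by blast
      qed
    qed
  qed (use Cons.prems st(2) 1 in auto)
qed auto

section \<open>Repaying the surplus\<close>

text \<open>Repays up to \<open>cap v\<close> units at \<open>v\<close>. Trying all vertices with
  caps that depend piecewise linearly on the point replaces the selection of a largest coordinate,
  which would not be continuous.\<close>

definition withdraw :: "('a \<Rightarrow> real) \<Rightarrow> 'a \<Rightarrow> ('a \<Rightarrow> real) \<times> real \<Rightarrow> ('a \<Rightarrow> real) \<times> real" where
  "withdraw cap v = (\<lambda>(f, r).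
     (f(v := f v - real (modulus div d v) * min (cap v) r), r - min (cap v) r))"

text \<open>A coordinate with positive cap can bear the whole surplus, and each vertex is visited
  only once, so nothing becomes negative.\<close>

lemma withdraw_fold:
  assumes "distinct vs" "set vs \<subseteq> V" "\<And>v. v \<in> set vs \<Longrightarrow> cap v \<ge> 0" and "r \<ge> 0"
    and "fold (withdraw cap) vs (f, r) = (f', r')"
    and "\<And>v. v \<in> V \<Longrightarrow> f v \<ge> 0"
    and "\<And>v. v \<in> set vs \<Longrightarrow> cap v > 0 \<Longrightarrow> f v \<ge> real modulus * r"
  shows "mass f' - real modulus * r' = mass f - real modulus * r \<and> 0 \<le> r' \<and>
    ((\<exists>v\<in>set vs. cap v \<ge> r) \<longrightarrow> r' = 0) \<and> (\<forall>v\<in>V. 0 \<le> f' v \<and> f' v \<le> f v) \<and> (r = 0 \<longrightarrow> f' = f)"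
  using assms
proof (induction vs arbitrary: f r)
  case (Cons v vs)
  define q where "q = min (cap v) r"
  define f1 where "f1 = f(v := f v - real (modulus div d v) * q)"
  have v: "v \<in> V" using Cons.prems by auto
  have q: "0 \<le> q" "q \<le> r" using Cons.prems(3)[of v] Cons.prems(4) by (auto simp: q_def)
  have dq: "real (modulus div d v) * q \<le> real modulus * q"
    using q by (intro mult_right_mono) (auto simp: div_le_dividend)
  have mr: "real modulus * q \<le> real modulus * r" using q by (intro mult_left_mono) auto
  have f1v: "0 \<le> f1 v"
  proof (cases "cap v > 0")
    case True
    then show ?thesis using Cons.prems(7)[of v] dq mr by (auto simp: f1_def)
  next
    case False
    then have "q = 0" using q by (auto simp: q_def)
    then show ?thesis using Cons.prems(6)[OF v] by (simp add: f1_def)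
  qed
  have w1: "withdraw cap v (f, r) = (f1, r - q)" by (simp add: withdraw_def f1_def q_def)
  have IH: "mass f' - real modulus * r' = mass f1 - real modulus * (r - q) \<and> 0 \<le> r' \<and>
    ((\<exists>v\<in>set vs. cap v \<ge> r - q) \<longrightarrow> r' = 0) \<and> (\<forall>v\<in>V. 0 \<le> f' v \<and> f' v \<le> f1 v) \<and> (r - q = 0 \<longrightarrow> f' = f1)"
  proof (rule Cons.IH)
    show "fold (withdraw cap) vs (f1, r - q) = (f', r')"
      using Cons.prems(5) w1 by simp
    show "f1 w \<ge> 0" if "w \<in> V" for w using that f1v Cons.prems(6)[of w] by (auto simp: f1_def)
    show "f1 w \<ge> real modulus * (r - q)" if "w \<in> set vs" "cap w > 0" for w
    proof -
      have "w \<noteq> v" using that Cons.prems(1) by auto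
      moreover have "real modulus * (r - q) \<le> real modulus * r" using q by (intro mult_left_mono) auto
      ultimately show ?thesis using Cons.prems(7)[of w] that by (auto simp: f1_def)
    qed
  qed (use Cons.prems q in auto)
  have "mass f1 = mass f - real modulus * q"
  proof -
    have "mass f1 = real (d v) * f1 v + (\<Sum>w\<in>V - {v}. real (d w) * f1 w)"
      unfolding mass_def using finite_V v by (rule sum.remove)
    moreover have "mass f = real (d v) * f v + (\<Sum>w\<in>V - {v}. real (d w) * f w)"
      unfolding mass_def using finite_V v by (rule sum.remove)
    moreover have "(\<Sum>w\<in>V - {v}. real (d w) * f1 w) = (\<Sum>w\<in>V - {v}. real (d w) * f w)"
      by (intro sum.cong) (auto simp: f1_def)
    moreover have "real (d v) * real (modulus div d v) = real modulus"
      using dvd_modulus[OF v] by (metis dvd_mult_div_cancel of_nat_mult)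
    ultimately show ?thesis by (simp add: f1_def algebra_simps)
  qed
  moreover have "f1 w \<le> f w" for w using q by (auto simp: f1_def)
  moreover have "r' = 0" if ex: "\<exists>w\<in>set (v # vs). cap w \<ge> r"
  proof (cases "cap v \<ge> r")
    case True
    then have "r - q = 0" by (simp add: q_def)
    \<comment> \<open>With nothing left to repay, any further vertex satisfies the condition
      \<open>cap w \<ge> 0\<close> of the induction hypothesis; only the empty list is
      separate.\<close>
    have r0: "r' \<le> 0 \<or> vs \<noteq> []" using IH \<open>r - q = 0\<close> Cons.prems(5) w1
      by (cases vs) auto
    show ?thesis
    proof (cases vs)
      case Nil then show ?thesis using IH r0 by auto
    next
      case (Cons w ws)
      then have "cap w \<ge> 0" using \<open>\<And>v'. v' \<in> set (v # vs) \<Longrightarrow> cap v' \<ge> 0\<close> by auto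
      then show ?thesis using IH \<open>r - q = 0\<close> Cons by auto
    qed
  next
    case False
    then obtain w where "w \<in> set vs" "cap w \<ge> r" using ex by auto
    then show ?thesis using IH q by (metis diff_add_cancel le_add_same_cancel1 order_trans)
  qed
  moreover have "f' = f" if "r = 0"
  proof -
    have "q = 0" using q that by auto
    then show ?thesis using IH that by (auto simp: f1_def)
  qed
  ultimately show ?case using IH by (auto simp: algebra_simps intro: order_trans)
qed auto

text \<open>The order of the steps does not depend on \<open>p\<close>, so the fold is a fixed
  composition of lattice operations and integer multiples.\<close>

lemma zpl_absorb_fold:
  assumes "\<And>S. S \<in> set Ss \<Longrightarrow> zpl (\<lambda>p :: real^'n. X p S)"
    and "\<And>v. v \<in> V \<Longrightarrow> zpl (\<lambda>p. f p v)" "zpl t" "zpl r"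
  shows "(\<forall>v\<in>V. zpl (\<lambda>p. fst (fold (absorb (X p)) Ss (f p, t p, r p)) v)) \<and>
    zpl (\<lambda>p. snd (snd (fold (absorb (X p)) Ss (f p, t p, r p))))"
  using assms
proof (induction Ss arbitrary: f t r)
  case (Cons S Ss)
  define x where "x p = min (X p S) (t p)" for p
  define u where "u p = t p - real (wt S) * x p" for p
  define f1 where "f1 p v = f p v + (if v \<in> S then x p else 0) + real (filler S v) * max 0 (- u p)" for p v
  have "absorb (X p) S (f p, t p, r p) = (f1 p, max 0 (u p), r p + real (quota S) * max 0 (- u p))" for p
    unfolding absorb_def f1_def u_def x_def by (simp add: Let_def)
  then have *: "fold (absorb (X p)) (S # Ss) (f p, t p, r p) =
      fold (absorb (X p)) Ss (f1 p, max 0 (u p), r p + real (quota S) * max 0 (- u p))" for p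
    by simp
  have x: "zpl x" unfolding x_def using Cons.prems by (intro zpl_min) auto
  have u: "zpl u" unfolding u_def using Cons.prems x by (intro zpl_diff zpl_of_nat_mult) auto
  have f1: "zpl (\<lambda>p. f1 p v)" if "v \<in> V" for v
    unfolding f1_def using that x u
    by (intro zpl_add zpl_of_nat_mult zpl_max zpl_minus zpl_if zpl_0 Cons.prems) auto
  show ?case
    unfolding * using Cons.prems x u f1
    by (intro Cons.IH zpl_max zpl_0 zpl_add zpl_of_nat_mult zpl_minus) auto
qed auto

lemma zpl_withdraw_fold:
  assumes "set vs \<subseteq> V" "\<And>v. v \<in> V \<Longrightarrow> zpl (\<lambda>p :: real^'n. cap p v)"
    and "\<And>v. v \<in> V \<Longrightarrow> zpl (\<lambda>p. f p v)" "zpl r"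
  shows "\<forall>v\<in>V. zpl (\<lambda>p. fst (fold (withdraw (cap p)) vs (f p, r p)) v)"
  using assms
proof (induction vs arbitrary: f r)
  case (Cons w vs)
  define q where "q p = min (cap p w) (r p)" for p
  define f1 where "f1 p = (f p)(w := f p w - real (modulus div d w) * q p)" for p
  have "withdraw (cap p) w (f p, r p) = (f1 p, r p - q p)" for p
    unfolding withdraw_def f1_def q_def by simp
  then have *: "fold (withdraw (cap p)) (w # vs) (f p, r p) = fold (withdraw (cap p)) vs (f1 p, r p - q p)" for p
    by simp
  have q: "zpl q" unfolding q_def using Cons.prems by (intro zpl_min) auto
  have f1: "zpl (\<lambda>p. f1 p v)" if "v \<in> V" for v
    unfolding f1_def fun_upd_def using that Cons.prems(1,3) q
    by (intro zpl_if zpl_diff zpl_of_nat_mult) auto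
  show ?case
    unfolding * using Cons.prems q f1 by (intro Cons.IH zpl_diff) auto
qed auto

section \<open>The retraction on coordinates and its constants\<close>

text \<open>The small quantity \<open>c\<close> of the overview. For nonnegative \<open>y\<close> it
  is zero exactly for points of the complex, since a set outside \<open>K\<close> contributes 0 only
  if one of its coordinates vanishes.\<close>

definition defect :: "('a \<Rightarrow> real) \<Rightarrow> real" where
  "defect y = \<bar>1 - mass y\<bar> + (\<Sum>J\<in>Pow V - K. Min (y ` J))"

text \<open>Only the range between \<open>c\<close> and \<open>2 * c\<close> is seen. A positive
  value means \<open>y v > c\<close>, which confines \<open>v\<close> to a simplex; all coordinates
  from \<open>2 * c\<close> on share the top value \<open>c\<close>.\<close>

definition cut :: "('a \<Rightarrow> real) \<Rightarrow> 'a \<Rightarrow> real" where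
  "cut y v = min (max 0 (y v - defect y)) (defect y)"

text \<open>The simplexes with positive layer form a chain, the superlevel sets of \<^term>\<open>cut y\<close>.\<close>

definition layer :: "('a \<Rightarrow> real) \<Rightarrow> 'a set \<Rightarrow> real" where
  "layer y S = max 0 (Min (cut y ` S) - Max (insert 0 (cut y ` (V - S))))"

definition strata :: "'a set list" where
  "strata = sort_key card (SOME xs. set xs = K - {{}})"

definition vertex_list :: "'a list" where
  "vertex_list = (SOME xs. set xs = V \<and> distinct xs)"

text \<open>Subtracting twice the defect makes every vertex of the support attain the top value of
  \<open>cut y\<close>, so the support lies in each simplex with positive layer.\<close>

definition base :: "('a \<Rightarrow> real) \<Rightarrow> 'a \<Rightarrow> real" where
  "base y v = max 0 (y v - 2 * defect y)"

definition slack :: "('a \<Rightarrow> real) \<Rightarrow> real" where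
  "slack y = max 0 (1 - mass (base y))"

text \<open>\<open>mass y\<close> is off 1 by at most \<open>defect y\<close>, and
  \<open>base\<close> lowers each coordinate by at most \<open>2 * defect y\<close>; together this
  bounds the slack by \<open>slope * defect y\<close>.\<close>

definition slope :: nat where
  "slope = 1 + 2 * (\<Sum>v\<in>V. d v)"

text \<open>If some coordinate is at least twice the defect, some layer is at least
  \<open>defect y / card V\<close> by \<open>ex_gap\<close>. Scaled by
  \<open>slope * card V\<close>, it alone exceeds the slack.\<close>

definition absorbed where
  "absorbed y = fold (absorb (\<lambda>S. real (slope * card V) * layer y S)) strata (base y, slack y, 0)"

text \<open>Absorbing a slack of at most \<open>slope * defect y\<close> creates at most
  \<open>debt_bound * defect y\<close> units of surplus.\<close>

definition debt_bound :: nat where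
  "debt_bound = (\<Sum>S\<leftarrow>strata. quota S * wt S) * slope"

text \<open>The 2 makes up for the subtraction in \<open>base\<close>; the remainder lets one
  coordinate above \<open>reserve * defect y\<close> pay the whole debt.\<close>

definition reserve :: nat where
  "reserve = 2 + modulus * debt_bound"

definition retr :: "('a \<Rightarrow> real) \<Rightarrow> 'a \<Rightarrow> real" where
  "retr y = fst (fold (withdraw (\<lambda>v. max 0 (y v - real reserve * defect y))) vertex_list
     (fst (absorbed y), snd (snd (absorbed y))))"

lemma finite_K: "finite K"
  using K_sub finite_V by (intro finite_subset[of K "Pow V"]) auto

lemma finite_simplex: "S \<in> K \<Longrightarrow> finite S"
  using K_sub finite_V finite_subset by blast

lemma set_strata: "set strata = K - {{}}" and sorted_strata: "sorted (map card strata)"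
proof -
  have "set (SOME xs. set xs = K - {{}}) = K - {{}}"
    by (rule someI_ex[of "\<lambda>xs. set xs = K - {{}}"]) (rule finite_list, use finite_K in simp)
  then show "set strata = K - {{}}" unfolding strata_def by simp
  show "sorted (map card strata)" unfolding strata_def by simp
qed

lemma vertex_list: "set vertex_list = V" "distinct vertex_list"
proof -
  have "set vertex_list = V \<and> distinct vertex_list"
    unfolding vertex_list_def
    by (rule someI_ex[of "\<lambda>xs. set xs = V \<and> distinct xs"]) (rule finite_distinct_list[OF finite_V])
  then show "set vertex_list = V" "distinct vertex_list" by auto
qed

lemma zpl_mass: "(\<And>v. v \<in> V \<Longrightarrow> zpl (\<lambda>p :: real^'n. y p v)) \<Longrightarrow> zpl (\<lambda>p. mass (y p))"
  unfolding mass_def by (intro zpl_sum zpl_of_nat_mult)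

lemma zpl_defect:
  assumes y: "\<And>v. v \<in> V \<Longrightarrow> zpl (\<lambda>p :: real^'n. y p v)"
  shows "zpl (\<lambda>p. defect (y p))"
  unfolding defect_def
proof (intro zpl_add zpl_abs zpl_diff zpl_1 zpl_sum)
  show "zpl (\<lambda>p. mass (y p))" using y by (rule zpl_mass)
  show "zpl (\<lambda>p. Min (y p ` J))" if "J \<in> Pow V - K" for J
    using that empty_K finite_V y by (intro zpl_Min) (auto intro: finite_subset)
qed

lemma zpl_layer:
  assumes y: "\<And>v. v \<in> V \<Longrightarrow> zpl (\<lambda>p :: real^'n. y p v)" and S: "S \<in> K" "S \<noteq> {}"
  shows "zpl (\<lambda>p. layer (y p) S)"
proof -
  have cut: "zpl (\<lambda>p. cut (y p) v)" if "v \<in> V" for v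
    unfolding cut_def using that
    by (intro zpl_min zpl_max zpl_0 zpl_diff y zpl_defect)
  have "zpl (\<lambda>p. Min (cut (y p) ` S))"
    using S finite_simplex K_sub cut by (intro zpl_Min) auto
  moreover have "zpl (\<lambda>p. Max (insert 0 (cut (y p) ` (V - S))))"
  proof (cases "V - S = {}")
    case True then show ?thesis by (simp only: True image_empty Max_singleton zpl_0)
  next
    case False
    have "Max (insert 0 (cut (y p) ` (V - S))) = max 0 (Max (cut (y p) ` (V - S)))" for p
      using False finite_V by (intro Max_insert) auto
    then show ?thesis using False finite_V cut by (simp only:) (intro zpl_max zpl_0 zpl_Max, auto)
  qed
  ultimately show ?thesis unfolding layer_def by (intro zpl_max zpl_0 zpl_diff)
qed

lemma zpl_retr:
  assumes y: "\<And>v. v \<in> V \<Longrightarrow> zpl (\<lambda>p :: real^'n. y p v)" and v: "v \<in> V"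
  shows "zpl (\<lambda>p. retr (y p) v)"
proof -
  have def: "zpl (\<lambda>p. real m * defect (y p))" for m
    using y by (intro zpl_of_nat_mult zpl_defect)
  have base: "zpl (\<lambda>p. base (y p) v)" if "v \<in> V" for v
    unfolding base_def using y[OF that] def[of 2] by (intro zpl_max zpl_0 zpl_diff) auto
  have slack: "zpl (\<lambda>p. slack (y p))"
    unfolding slack_def using base by (intro zpl_max zpl_0 zpl_diff zpl_1 zpl_mass)
  have abs: "(\<forall>v\<in>V. zpl (\<lambda>p. fst (absorbed (y p)) v)) \<and> zpl (\<lambda>p. snd (snd (absorbed (y p))))"
    unfolding absorbed_def
    by (intro zpl_absorb_fold zpl_of_nat_mult zpl_layer y base slack zpl_0) (auto simp: set_strata)
  have "\<forall>v\<in>V. zpl (\<lambda>p. fst (fold (withdraw (\<lambda>v. max 0 (y p v - real reserve * defect (y p)))) vertex_list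
     (fst (absorbed (y p)), snd (snd (absorbed (y p))))) v)"
    using abs by (intro zpl_withdraw_fold zpl_max zpl_0 zpl_diff y def) (auto simp: vertex_list)
  then show ?thesis using v unfolding retr_def by blast
qed

section \<open>Estimates for the retraction\<close>

text \<open>Pigeonhole: the \<open>card V - 1\<close> values at vertices other than
  \<open>v0\<close> cannot meet all \<open>card V\<close> intervals of length
  \<open>c / card V\<close> between 0 and \<open>c\<close>. A missed interval separates a superlevel
  set from its complement.\<close>

lemma ex_gap:
  fixes z :: "'a \<Rightarrow> real"
  assumes c: "c > 0" and v0: "v0 \<in> V" "z v0 = c" and z: "\<And>v. v \<in> V \<Longrightarrow> 0 \<le> z v"
  shows "\<exists>S\<subseteq>V. S \<noteq> {} \<and> Min (z ` S) - Max (insert 0 (z ` (V - S))) \<ge> c / card V"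
proof -
  define k where "k = card V"
  have k: "k > 0" using v0 finite_V by (auto simp: k_def card_gt_0_iff)
  \<comment> \<open>The index of the interval containing \<open>z v\<close>; the intervals are open
    on the left and closed on the right.\<close>
  define g where "g v = \<lceil>z v * k / c\<rceil> - 1" for v
  have "card (g ` (V - {v0})) \<le> card (V - {v0})" using finite_V by (intro card_image_le) auto
  also have "\<dots> < k" using v0 finite_V k by (simp add: k_def)
  finally have "card (g ` (V - {v0})) < card {0..<int k}" by simp
  then have "\<not> {0..<int k} \<subseteq> g ` (V - {v0})"
    using card_mono[of "g ` (V - {v0})" "{0..<int k}"] finite_V by auto
  then obtain l where l: "0 \<le> l" "l < int k" "\<And>v. v \<in> V \<Longrightarrow> v \<noteq> v0 \<Longrightarrow> g v \<noteq> l" by force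
  define S where "S = {v \<in> V. z v \<ge> (l + 1) * c / k}"
  have "(l + 1) * c \<le> k * c" using l(2) c by (intro mult_right_mono) auto
  then have "(l + 1) * c / k \<le> c" using k by (simp add: divide_simps mult.commute)
  then have v0S: "v0 \<in> S" using v0 by (simp add: S_def)
  have fin: "finite S" "finite (V - S)" using finite_V by (auto simp: S_def)
  have "Min (z ` S) \<ge> (l + 1) * c / k"
    using v0S fin by (subst Min_ge_iff) (auto simp: S_def)
  moreover have "Max (insert 0 (z ` (V - S))) \<le> l * c / k"
  proof -
    have "z v \<le> l * c / k" if v: "v \<in> V" "v \<notin> S" for v
    proof (rule ccontr)
      assume "\<not> z v \<le> l * c / k"
      moreover have "z v < (l + 1) * c / k" using v by (auto simp: S_def)
      ultimately have "real_of_int l < z v * k / c" "z v * k / c < l + 1"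
        using c k by (auto simp: field_simps)
      then have "\<lceil>z v * k / c\<rceil> = l + 1" by (simp add: ceiling_eq_iff)
      then have "g v = l" by (simp add: g_def)
      then show False using l(3) v v0S by blast
    qed
    moreover have "0 \<le> l * c / k" using l(1) c by simp
    ultimately show ?thesis using fin by (subst Max_le_iff) auto
  qed
  moreover have "(l + 1) * c / k - l * c / k = c / k" by (simp add: diff_divide_distrib[symmetric] algebra_simps)
  ultimately have "Min (z ` S) - Max (insert 0 (z ` (V - S))) \<ge> c / card V"
    by (simp add: k_def)
  then show ?thesis using v0S by (intro exI[of _ S]) (auto simp: S_def)
qed

context
  fixes y :: "'a \<Rightarrow> real"
  assumes y_nonneg: "\<And>v. v \<in> V \<Longrightarrow> 0 \<le> y v"
begin

lemma Min_nonneg: "J \<in> Pow V - K \<Longrightarrow> 0 \<le> Min (y ` J)"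
  using empty_K finite_V y_nonneg finite_subset[of J V] by (subst Min_ge_iff) auto

lemma defect_nonneg: "0 \<le> defect y" and mass_defect: "\<bar>1 - mass y\<bar> \<le> defect y"
  unfolding defect_def using Min_nonneg sum_nonneg[of "Pow V - K" "\<lambda>J. Min (y ` J)"]
  by (auto intro: add_nonneg_nonneg)

text \<open>Otherwise the minimum of \<open>y\<close> over this set would be one of the summands of
  \<open>defect y\<close>, although it exceeds \<open>defect y\<close>.\<close>

lemma above_defect_simplex: "{v \<in> V. y v > defect y} \<in> K" (is "?J \<in> K")
proof (rule ccontr)
  assume J: "?J \<notin> K"
  then have ne: "?J \<noteq> {}" using empty_K by metis
  have "Min (y ` ?J) \<le> (\<Sum>J\<in>Pow V - K. Min (y ` J))"
    using J finite_V Min_nonneg by (intro member_le_sum) auto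
  then have "Min (y ` ?J) \<le> defect y" unfolding defect_def by linarith
  moreover have "Min (y ` ?J) > defect y" using ne finite_V by (subst Min_gr_iff) auto
  ultimately show False by simp
qed

lemma defect_eq_0:
  assumes "supp y \<in> K" "mass y = 1"
  shows "defect y = 0"
proof -
  have "Min (y ` J) = 0" if J: "J \<in> Pow V - K" for J
  proof -
    have "\<not> J \<subseteq> supp y" using J assms(1) K_down by blast
    then obtain v where v: "v \<in> J" "y v \<le> 0" using J by (force simp: supp_def)
    have "Min (y ` J) \<le> y v" using v J finite_V finite_subset[of J V] by (intro Min_le) auto
    then show ?thesis using v Min_nonneg[OF J] by simp
  qed
  then show ?thesis using assms(2) by (simp add: defect_def)
qed

lemma slack_le: "slack y \<le> real slope * defect y"
proof -
  have "mass y - 2 * defect y * (\<Sum>v\<in>V. real (d v)) = (\<Sum>v\<in>V. real (d v) * (y v - 2 * defect y))"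
    unfolding mass_def by (simp add: right_diff_distrib sum_subtractf sum_distrib_left sum_distrib_right algebra_simps)
  also have "\<dots> \<le> mass (base y)"
    unfolding mass_def base_def by (intro sum_mono mult_left_mono) auto
  finally have "1 - mass (base y) \<le> real slope * defect y"
    using mass_defect by (simp add: slope_def algebra_simps)
  moreover have "0 \<le> real slope * defect y" using defect_nonneg by simp
  ultimately show ?thesis unfolding slack_def by simp
qed

lemma layer_nonneg: "0 \<le> layer y S"
  by (simp add: layer_def)

lemma layer_pos:
  assumes "layer y S > 0" "S \<in> K" "S \<noteq> {}" "v \<in> S" "w \<in> V - S"
  shows "cut y w < cut y v"
proof -
  have "Min (cut y ` S) \<le> cut y v" using assms finite_simplex by (intro Min_le) auto
  moreover have "cut y w \<le> Max (insert 0 (cut y ` (V - S)))" using assms finite_V by (intro Max_ge) auto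
  ultimately show ?thesis using assms(1) by (simp add: layer_def)
qed

lemma absorbed_props:
  assumes "absorbed y = (f, t, r)"
  shows "mass f + t - real modulus * r = mass (base y) + slack y"
    and "0 \<le> t" "base y v \<le> f v" "0 \<le> r" "r \<le> real debt_bound * defect y" "supp f \<in> K"
    and "v0 \<in> V \<Longrightarrow> y v0 \<ge> 2 * defect y \<Longrightarrow> t = 0"
    and "defect y = 0 \<Longrightarrow> f = base y \<and> r = 0"
proof -
  let ?X = "\<lambda>S. real (slope * card V) * layer y S"
  have Ss: "\<And>S. S \<in> set strata \<Longrightarrow> S \<in> K \<and> S \<noteq> {} \<and> ?X S \<ge> 0"
    using layer_nonneg by (auto simp: set_strata)
  have pos: "layer y S > 0" if "?X S > 0" for S
    using that layer_nonneg[of S] by (cases "layer y S = 0") auto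
  have sl: "slack y \<ge> 0" by (simp add: slack_def)
  have eq: "fold (absorb ?X) strata (base y, slack y, 0) = (f, t, r)"
    using assms unfolding absorbed_def .
  note F = absorb_fold[OF Ss sl eq]
  show "mass f + t - real modulus * r = mass (base y) + slack y" "0 \<le> t" "base y v \<le> f v" "0 \<le> r"
    using F by auto
  have "r \<le> (\<Sum>S\<leftarrow>strata. real (quota S * wt S)) * slack y" using F by auto
  also have "\<dots> \<le> (\<Sum>S\<leftarrow>strata. real (quota S * wt S)) * (real slope * defect y)"
    using slack_le by (intro mult_left_mono sum_list_nonneg) auto
  also have "\<dots> = real debt_bound * defect y"
    by (simp add: debt_bound_def real_of_nat_sum_list)
  finally show "r \<le> real debt_bound * defect y" .
  have t0: "slack y = 0" if "defect y = 0" using slack_le sl that by simp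
  show "f = base y \<and> r = 0" if "defect y = 0" using F t0[OF that] by auto
  show "t = 0" if v0: "v0 \<in> V" "y v0 \<ge> 2 * defect y"
  proof (cases "defect y = 0")
    case True
    then show ?thesis using F t0 by auto
  next
    case False
    then have c: "defect y > 0" using defect_nonneg by simp
    have "cut y v0 = defect y" using v0(2) c by (simp add: cut_def)
    moreover have "0 \<le> cut y v" for v using c by (simp add: cut_def)
    ultimately obtain S where S: "S \<subseteq> V" "S \<noteq> {}"
      and gap: "Min (cut y ` S) - Max (insert 0 (cut y ` (V - S))) \<ge> defect y / card V"
      using ex_gap[OF c v0(1)] by metis
    have cV: "card V > 0" using v0 finite_V by (auto simp: card_gt_0_iff)
    have "0 \<le> Max (insert 0 (cut y ` (V - S)))" using finite_V by (intro Max_ge) auto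
    moreover have "defect y / card V > 0" using c cV by simp
    ultimately have "0 < Min (cut y ` S)" using gap by linarith
    then have "\<forall>v\<in>S. 0 < cut y v" using S finite_V finite_subset[of S V] by (subst (asm) Min_gr_iff) auto
    then have "S \<subseteq> {v \<in> V. y v > defect y}" using S by (auto simp: cut_def)
    then have SK: "S \<in> set strata" using above_defect_simplex K_down S(2) by (auto simp: set_strata)
    have "slack y \<le> real slope * defect y" by (rule slack_le)
    also have "\<dots> = real (slope * card V) * (defect y / card V)" using cV by simp
    also have "\<dots> \<le> ?X S" using gap by (intro mult_left_mono) (auto simp: layer_def)
    finally show ?thesis using F SK by blast
  qed
  show "supp f \<in> K"
  proof (rule absorb_fold_supp[OF Ss sl eq sorted_strata])
    show "S \<subseteq> T \<or> T \<subseteq> S" if "S \<in> set strata" "T \<in> set strata" "?X S > 0" "?X T > 0" for S T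
    proof (rule ccontr)
      assume "\<not> (S \<subseteq> T \<or> T \<subseteq> S)"
      then obtain a b where ab: "a \<in> S" "a \<notin> T" "b \<in> T" "b \<notin> S" by blast
      have "layer y S > 0" "layer y T > 0" "a \<in> V" "b \<in> V" "S \<in> K" "T \<in> K"
        using that(1,2) pos[OF that(3)] pos[OF that(4)] ab K_sub by (auto simp: set_strata)
      then show False using layer_pos[of S a b] layer_pos[of T b a] ab by force
    qed
    have "supp (base y) \<subseteq> {v \<in> V. y v > defect y}"
      using defect_nonneg by (auto simp: supp_def base_def)
    then show "supp (base y) \<in> K" using above_defect_simplex K_down by blast
    show "supp (base y) \<subseteq> S" if S: "S \<in> set strata" "?X S > 0" "slack y > 0" for S
    proof
      fix w assume w: "w \<in> supp (base y)"
      show "w \<in> S"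
      proof (rule ccontr)
        assume "w \<notin> S"
        obtain v where "v \<in> S" using S by (auto simp: set_strata)
        then have "cut y w < cut y v"
          using layer_pos[of S v w] S(1) pos[OF S(2)] w \<open>w \<notin> S\<close> by (auto simp: set_strata supp_def)
        moreover have "cut y w = defect y"
          using w defect_nonneg by (auto simp: cut_def supp_def base_def)
        moreover have "cut y v \<le> defect y" by (simp add: cut_def)
        ultimately show False by simp
      qed
    qed
  qed
qed

text \<open>With defect 0 there is no slack to absorb and no surplus to repay.\<close>

lemma retr_fixed:
  assumes "supp y \<in> K" "mass y = 1" "v \<in> V"
  shows "retr y v = y v"
proof -
  have c: "defect y = 0" using assms by (intro defect_eq_0)
  obtain f t r where a: "absorbed y = (f, t, r)" by (metis prod_cases3)
  have f: "f = base y" "r = 0" using absorbed_props(8)[OF a c] by auto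
  obtain f' r' where w: "fold (withdraw (\<lambda>v. max 0 (y v - real reserve * defect y))) vertex_list (f, r) = (f', r')"
    by fastforce
  have "f' = f"
    using withdraw_fold[OF _ _ _ _ w] f vertex_list y_nonneg by (auto simp: base_def)
  then show ?thesis unfolding retr_def a using w f c y_nonneg[OF assms(3)] by (simp add: base_def)
qed

text \<open>The large coordinate at \<open>v0\<close> is used three times: it keeps
  \<open>mass (base y)\<close> below 1, it yields a layer that clears the slack, and its cap covers
  the surplus.\<close>

lemma retr_simplex:
  assumes v0: "v0 \<in> V" "y v0 \<ge> real (reserve + debt_bound) * defect y"
  shows "\<And>v. v \<in> V \<Longrightarrow> 0 \<le> retr y v" and "mass (retr y) = 1" and "supp (retr y) \<in> K"
proof -
  let ?c = "defect y"
  let ?cap = "\<lambda>v. max 0 (y v - real reserve * ?c)"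
  obtain f t r where a: "absorbed y = (f, t, r)" by (metis prod_cases3)
  note A = absorbed_props[OF a]
  obtain f' r' where w: "fold (withdraw ?cap) vertex_list (f, r) = (f', r')" by fastforce
  have "2 * ?c \<le> real (reserve + debt_bound) * ?c"
    using defect_nonneg by (intro mult_right_mono) (auto simp: reserve_def)
  then have v02: "y v0 \<ge> 2 * ?c" using v0 by linarith
  \<comment> \<open>The loss \<open>2 * defect y\<close> at \<open>v0\<close> alone outweighs the
    excess of \<open>mass y\<close> over 1, so the truncation in \<open>slack\<close> is harmless
    and \<open>slack y\<close> is exactly the missing mass.\<close>
  have "mass (base y) \<le> 1"
  proof -
    have "real (d v0) \<ge> 1" using d_pos[OF v0(1)] by simp
    have "mass (base y) = real (d v0) * base y v0 + (\<Sum>v\<in>V - {v0}. real (d v) * base y v)"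
      unfolding mass_def using finite_V v0 by (intro sum.remove) auto
    also have "(\<Sum>v\<in>V - {v0}. real (d v) * base y v) \<le> (\<Sum>v\<in>V - {v0}. real (d v) * y v)"
      using defect_nonneg y_nonneg by (intro sum_mono mult_left_mono) (auto simp: base_def)
    also have "real (d v0) * base y v0 = real (d v0) * y v0 - real (d v0) * (2 * ?c)"
      using v02 by (simp add: base_def algebra_simps)
    also have "real (d v0) * y v0 - real (d v0) * (2 * ?c) + (\<Sum>v\<in>V - {v0}. real (d v) * y v)
        = mass y - real (d v0) * (2 * ?c)"
      unfolding mass_def using sum.remove[OF finite_V v0(1), of "\<lambda>v. real (d v) * y v"] by simp
    finally have "mass (base y) \<le> mass y - real (d v0) * (2 * ?c)" by simp
    moreover have "1 * (2 * ?c) \<le> real (d v0) * (2 * ?c)"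
      using \<open>real (d v0) \<ge> 1\<close> defect_nonneg by (intro mult_right_mono) auto
    ultimately show ?thesis using mass_defect defect_nonneg by linarith
  qed
  then have "mass (base y) + slack y = 1" by (simp add: slack_def)
  then have m: "mass f - real modulus * r = 1" using A(1) A(7)[OF v0(1) v02] by simp
  have mr: "real modulus * r \<le> real modulus * (real debt_bound * ?c)" using A(5) by (intro mult_left_mono) auto
  have f0: "0 \<le> f v" for v using A(3)[of v] by (simp add: base_def max_def split: if_splits)
  have W: "mass f' - real modulus * r' = mass f - real modulus * r \<and> 0 \<le> r' \<and>
    ((\<exists>v\<in>set vertex_list. ?cap v \<ge> r) \<longrightarrow> r' = 0) \<and> (\<forall>v\<in>V. 0 \<le> f' v \<and> f' v \<le> f v) \<and> (r = 0 \<longrightarrow> f' = f)"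
  proof (rule withdraw_fold[OF vertex_list(2) _ _ A(4) w])
    show "f v \<ge> real modulus * r" if "?cap v > 0" for v
    proof -
      have "y v > real reserve * ?c" using that by simp
      then have "y v - 2 * ?c > real modulus * (real debt_bound * ?c)"
        by (simp add: reserve_def algebra_simps)
      then show ?thesis using mr A(3)[of v] by (simp add: base_def)
    qed
  qed (use vertex_list f0 in auto)
  have "?cap v0 \<ge> r" using v0(2) A(5) by (simp add: algebra_simps)
  then have r': "r' = 0" using W v0(1) vertex_list by blast
  have retr: "retr y = f'" unfolding retr_def a using w by simp
  show "0 \<le> retr y v" if "v \<in> V" for v using W that unfolding retr by blast
  show "mass (retr y) = 1" using W r' m unfolding retr by simp
  have "supp f' \<subseteq> supp f" using W by (auto simp: supp_def intro: less_le_trans)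
  then show "supp (retr y) \<in> K" using A(6) K_down unfolding retr by blast
qed

end

end

section \<open>Approximating a continuous retraction\<close>

text \<open>The values at \<open>x\<close> of integer affine functions form a subgroup of the reals containing 1; if
  it has no element in \<open>(0, 1/D)\<close>, it is generated by some \<open>1/d\<close> with \<open>d \<le> D\<close>.\<close>

lemma ex_small_value:
  fixes x :: "real^'n"
  assumes D: "D > 0" and x: "\<And>d. 0 < d \<Longrightarrow> d \<le> D \<Longrightarrow> \<exists>i. real d * x $ i \<notin> \<int>"
  shows "\<exists>l. int_affine l \<and> 0 < l x \<and> l x < 1 / real D"
proof (rule ccontr)
  assume no: "\<not> ?thesis"
  have ge: "1 / real D \<le> l x" if "int_affine l" "0 < l x" for l
    using no that by (meson not_le)
  \<comment> \<open>Values rounded down to units of \<open>1 / D\<close> give a well-founded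
    measure. It separates \<open>l' x\<close> from \<open>l0 x\<close> if
    \<open>0 < l' x < l0 x\<close>, as their difference is itself a positive value and hence at
    least \<open>1 / D\<close>.\<close>
  define h where "h l = nat \<lfloor>l x * real D\<rfloor>" for l :: "real^'n \<Rightarrow> real"
  obtain l0 where l0: "int_affine l0" "0 < l0 x"
    and least: "\<And>l. int_affine l \<Longrightarrow> 0 < l x \<Longrightarrow> h l0 \<le> h l"
    using ex_has_least_nat[of "\<lambda>l. int_affine l \<and> 0 < l x" "\<lambda>x. 1" h] int_affine_const by auto
  define \<theta> where "\<theta> = l0 x"
  have \<theta>: "0 < \<theta>" using l0 by (simp add: \<theta>_def)
  have mult: "\<exists>k. l x = of_int k * \<theta>" if l: "int_affine l" for l
  proof -
    define k where "k = \<lfloor>l x / \<theta>\<rfloor>"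
    define l' where "l' = (\<lambda>x. l x - of_int k * l0 x)"
    have l': "int_affine l'" unfolding l'_def by (intro int_affine_diff int_affine_of_int_mult l l0)
    have l'': "int_affine (\<lambda>x. l0 x - l' x)" by (intro int_affine_diff l' l0)
    have "of_int k \<le> l x / \<theta>" "l x / \<theta> < of_int k + 1" unfolding k_def by linarith+
    then have bnd: "0 \<le> l' x" "l' x < \<theta>" using \<theta> by (auto simp: l'_def \<theta>_def[symmetric] field_simps)
    have "l' x = 0"
    proof (rule ccontr)
      assume "l' x \<noteq> 0"
      then have pos: "0 < l' x" using bnd by simp
      have "1 / real D \<le> l0 x - l' x" using ge[OF l''] bnd by (simp add: \<theta>_def)
      then have "l' x * real D + 1 \<le> l0 x * real D" using D by (simp add: field_simps)
      then have "\<lfloor>l' x * real D\<rfloor> + 1 \<le> \<lfloor>l0 x * real D\<rfloor>" by linarith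
      moreover have "0 \<le> \<lfloor>l' x * real D\<rfloor>" using pos by simp
      ultimately have "h l' < h l0" unfolding h_def by linarith
      then show False using least[OF l' pos] by simp
    qed
    then show ?thesis by (auto simp: l'_def \<theta>_def)
  qed
  \<comment> \<open>Thus \<theta> is \<open>1 / d\<close>, and every coordinate of \<open>x\<close>
    is an integer multiple of it.\<close>
  obtain d where d: "1 = of_int d * \<theta>" using mult[OF int_affine_const] by blast
  have dpos: "0 < d" using d \<theta> by (metis of_int_0_less_iff zero_less_mult_pos2 zero_less_one)
  have "\<theta> \<ge> 1 / real D" using ge[OF l0] by (simp add: \<theta>_def)
  then have "of_int d * (1 / real D) \<le> 1" using d dpos
    by (metis mult_left_mono of_int_0_le_iff order_less_imp_le)
  then have "real_of_int d \<le> real D" using D by (simp add: field_simps)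
  then have "nat d \<le> D" by simp
  then obtain i where i: "real (nat d) * x $ i \<notin> \<int>" using x[of "nat d"] dpos by auto
  obtain k where "x $ i = of_int k * \<theta>" using mult[OF int_affine_coord] by blast
  then have "of_int d * x $ i = of_int k" using d by (metis mult.assoc mult.commute mult.right_neutral)
  then show False using i dpos by simp
qed

lemma ex_approx_value:
  fixes x :: "real^'n"
  assumes "D > 0" "\<And>d. 0 < d \<Longrightarrow> d \<le> D \<Longrightarrow> \<exists>i. real d * x $ i \<notin> \<int>"
  shows "\<exists>f. zpl f \<and> \<bar>f x - r\<bar> < 1 / real D"
proof -
  obtain l where l: "int_affine l" "0 < l x" "l x < 1 / real D" using ex_small_value[OF assms] by blast
  define k where "k = \<lfloor>r / l x\<rfloor>"
  have "of_int k \<le> r / l x" "r / l x < of_int k + 1" unfolding k_def by linarith+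
  then have "of_int k * l x \<le> r" "r < of_int k * l x + l x" using l(2) by (auto simp: field_simps)
  then have "\<bar>of_int k * l x - r\<bar> < 1 / real D" using l(3) by linarith
  then show ?thesis
    using zpl_of_int_mult[OF zpl_int_affine[OF l(1)], of k] by blast
qed

definition low_den :: "nat \<Rightarrow> (real^'n) set" where
  "low_den D = {x \<in> cbox 0 1. \<exists>d\<in>{1..D}. \<forall>i. real d * x $ i \<in> \<int>}"

lemma finite_low_den: "finite (low_den D :: (real^'n) set)"
proof -
  define A where "A = (\<lambda>(k, d). real k / real d) ` ({0..D} \<times> {1..D})"
  have "low_den D \<subseteq> vec_lambda ` (PiE (UNIV :: 'n set) (\<lambda>_. A))"
  proof
    fix x :: "real^'n" assume "x \<in> low_den D"
    then obtain d where x: "x \<in> cbox 0 1" and d: "1 \<le> d" "d \<le> D" "\<And>i. real d * x $ i \<in> \<int>"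
      unfolding low_den_def by auto
    have "x $ i \<in> A" for i
    proof -
      obtain k where k: "real d * x $ i = of_int k" using d(3) by (rule Ints_cases)
      have xi: "0 \<le> x $ i" "x $ i \<le> 1" using x by (auto simp: mem_box_cart)
      then have "0 \<le> real d * x $ i" "real d * x $ i \<le> real d * 1" using mult_left_mono[of "x $ i" 1 "real d"] by auto
      then have "0 \<le> k" "k \<le> int d" using k by auto
      moreover have "x $ i = real (nat k) / real d" using k d \<open>0 \<le> k\<close> by (simp add: field_simps)
      ultimately show ?thesis unfolding A_def using d by (intro image_eqI[of _ _ "(nat k, d)"]) auto
    qed
    then show "x \<in> vec_lambda ` (PiE (UNIV :: 'n set) (\<lambda>_. A))"
      by (intro image_eqI[of _ _ "\<lambda>i. x $ i"]) auto
  qed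
  moreover have "finite (PiE (UNIV :: 'n set) (\<lambda>_. A))" unfolding A_def by (intro finite_PiE) auto
  ultimately show ?thesis using finite_surj by blast
qed

text \<open>\<open>x\<close> may be irrational, so \<open>N * z $ i\<close> is compared with
  integers near \<open>N * x $ i\<close>; the rounding is compensated by a large
  \<open>N\<close>.\<close>

lemma ex_zpl_bump:
  fixes x :: "real^'n"
  assumes "open U" "x \<in> U"
  shows "\<exists>s W. zpl s \<and> open W \<and> x \<in> W \<and> (\<forall>z. 0 \<le> s z) \<and> (\<forall>z\<in>W. s z = 0) \<and> (\<forall>z. z \<notin> U \<longrightarrow> 1 \<le> s z)"
proof -
  obtain e where e: "e > 0" "ball x e \<subseteq> U" using assms open_contains_ball by blast
  define e' where "e' = e / real CARD('n)"
  have e': "e' > 0" using e by (simp add: e'_def)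
  \<comment> \<open>Outside \<open>U\<close> some coordinate differs from that of \<open>x\<close>
    by at least \<open>e'\<close>. Rounding and the margin 1 use up less than 2 of the 3, so at
    least 1 is left.\<close>
  obtain N :: nat where N: "3 < real N * e'" using ex_less_of_nat_mult[OF e'] by blast
  then have Npos: "real N > 0" using e' by (cases "N = 0") auto
  define s where "s z = (\<Sum>i\<in>UNIV. max 0 (real N * z $ i - of_int (\<lceil>real N * x $ i\<rceil> + 1))
      + max 0 (of_int (\<lfloor>real N * x $ i\<rfloor> - 1) - real N * z $ i))" for z :: "real^'n"
  have "zpl s" unfolding s_def
    by (intro zpl_sum zpl_add zpl_max zpl_diff zpl_0 zpl_const zpl_of_nat_mult zpl_coord)
  moreover have "0 \<le> s z" for z unfolding s_def by (intro sum_nonneg) auto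
  moreover have "s z = 0" if "z \<in> ball x (1 / real N)" for z
  proof -
    have "real N * \<bar>z $ i - x $ i\<bar> < 1" for i
    proof -
      have "\<bar>z $ i - x $ i\<bar> < 1 / real N"
        using component_le_norm_cart[of "z - x" i] that by (simp add: dist_norm norm_minus_commute)
      then show ?thesis using Npos by (simp add: field_simps)
    qed
    then have "\<bar>real N * z $ i - real N * x $ i\<bar> < 1" for i
      by (simp add: abs_mult right_diff_distrib[symmetric])
    then have z: "real N * z $ i < real N * x $ i + 1" "real N * x $ i - 1 < real N * z $ i" for i
      using abs_less_iff by (metis add.commute diff_less_eq less_diff_eq minus_diff_eq)+
    have "real N * z $ i < of_int (\<lceil>real N * x $ i\<rceil> + 1)" "of_int (\<lfloor>real N * x $ i\<rfloor> - 1) < real N * z $ i" for i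
      using z[of i] le_of_int_ceiling[of "real N * x $ i"] of_int_floor_le[of "real N * x $ i"]
      unfolding of_int_add of_int_diff of_int_1 by linarith+
    then have "max 0 (real N * z $ i - of_int (\<lceil>real N * x $ i\<rceil> + 1))
      + max 0 (of_int (\<lfloor>real N * x $ i\<rfloor> - 1) - real N * z $ i) = 0" for i
      by (simp add: max_absorb1 less_imp_le)
    then show ?thesis unfolding s_def by (intro sum.neutral) simp
  qed
  moreover have "1 \<le> s z" if "z \<notin> U" for z
  proof -
    have "e \<le> norm (z - x)" using that e(2) by (auto simp: dist_norm norm_minus_commute not_less[symmetric])
    also have "\<dots> \<le> (\<Sum>i\<in>UNIV. \<bar>(z - x) $ i\<bar>)" by (rule norm_le_l1_cart)
    finally have "\<exists>i. e' \<le> \<bar>(z - x) $ i\<bar>"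
    proof -
      assume a: "e \<le> (\<Sum>i\<in>UNIV. \<bar>(z - x) $ i\<bar>)"
      show ?thesis
      proof (rule ccontr)
        assume "\<not> ?thesis"
        then have "(\<Sum>i\<in>UNIV. \<bar>(z - x) $ i\<bar>) < (\<Sum>i\<in>(UNIV::'n set). e')"
          by (intro sum_strict_mono) (auto simp: not_le)
        then show False using a by (simp add: e'_def)
      qed
    qed
    then obtain i where i: "e' \<le> \<bar>z $ i - x $ i\<bar>" by auto
    then have "real N * e' \<le> \<bar>real N * z $ i - real N * x $ i\<bar>"
      using Npos by (simp add: abs_mult right_diff_distrib[symmetric])
    then have "1 \<le> max 0 (real N * z $ i - of_int (\<lceil>real N * x $ i\<rceil> + 1))
      + max 0 (of_int (\<lfloor>real N * x $ i\<rfloor> - 1) - real N * z $ i)"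
      using N of_int_ceiling_diff_one_le[of "real N * x $ i"] floor_correct[of "real N * x $ i"]
      unfolding of_int_add of_int_diff of_int_1 by linarith
    also have "\<dots> \<le> s z" unfolding s_def
      by (rule member_le_sum) auto
    finally show ?thesis .
  qed
  ultimately show ?thesis using Npos by (intro exI[of _ s] exI[of _ "ball x (1 / real N)"]) auto
qed

text \<open>As in the lattice form of the Stone--Weierstrass theorem, functions that are below
  \<open>\<phi> + e\<close> everywhere and above \<open>\<phi> - e\<close> near a given point are joined by a finite maximum.\<close>

lemma zpl_approximation:
  fixes \<phi> :: "real^'n \<Rightarrow> real"
  assumes cont: "continuous_on (cbox 0 1) \<phi>"
    and pt: "\<And>x. x \<in> cbox 0 1 \<Longrightarrow> \<exists>f. zpl f \<and> \<bar>f x - \<phi> x\<bar> < e"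
  shows "\<exists>f. zpl f \<and> (\<forall>x\<in>cbox 0 1. \<bar>f x - \<phi> x\<bar> < e)"
proof -
  let ?C = "cbox 0 1 :: (real^'n) set"
  have "\<exists>f W. zpl f \<and> open W \<and> x \<in> W \<and> (\<forall>z\<in>?C. f z < \<phi> z + e) \<and> (\<forall>z\<in>?C \<inter> W. \<phi> z - e < f z)"
    if x: "x \<in> ?C" for x
  proof -
    obtain g where g: "zpl g" "\<bar>g x - \<phi> x\<bar> < e" using pt[OF x] by blast
    have gc: "continuous_on ?C (\<lambda>z. \<bar>g z - \<phi> z\<bar>)"
      using cont continuous_zpl[OF g(1)] by (intro continuous_on_rabs continuous_on_diff)
    then have "openin (top_of_set ?C) (?C \<inter> (\<lambda>z. \<bar>g z - \<phi> z\<bar>) -` {..<e})"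
      by (intro continuous_openin_preimage_gen) auto
    then obtain U where U: "open U" "?C \<inter> (\<lambda>z. \<bar>g z - \<phi> z\<bar>) -` {..<e} = ?C \<inter> U"
      unfolding openin_open by blast
    have xU: "x \<in> U" using U(2) x g(2) by auto
    have in_U: "\<bar>g z - \<phi> z\<bar> < e" if "z \<in> ?C" "z \<in> U" for z using U(2) that by auto
    obtain s W where s: "zpl s" "open W" "x \<in> W" "\<And>z. 0 \<le> s z" "\<And>z. z \<in> W \<Longrightarrow> s z = 0"
      "\<And>z. z \<notin> U \<Longrightarrow> 1 \<le> s z"
      using ex_zpl_bump[OF U(1) xU] by metis
    have "compact ((\<lambda>z. \<bar>g z - \<phi> z\<bar>) ` ?C)" using gc compact_cbox by (rule compact_continuous_image)
    then obtain B where B: "\<And>z. z \<in> ?C \<Longrightarrow> \<bar>g z - \<phi> z\<bar> \<le> B"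
      using compact_imp_bounded bounded_has_Sup(1) by (meson bounded_real image_eqI order_trans abs_le_D1)
    \<comment> \<open>Outside \<open>U\<close> the subtracted term is at least \<open>M\<close> and
      beats the error \<open>B\<close>; inside \<open>U\<close> it can only lower \<open>g\<close>,
      and on \<open>W\<close> it is zero.\<close>
    obtain M :: nat where M: "B < real M" using reals_Archimedean2 by blast
    define f where "f z = g z - real M * s z" for z
    have "zpl f" unfolding f_def using g s by (intro zpl_diff zpl_of_nat_mult)
    moreover have "f z < \<phi> z + e" if z: "z \<in> ?C" for z
    proof (cases "z \<in> U")
      case True
      then show ?thesis using in_U[OF z True] s(4)[of z] by (simp add: f_def abs_less_iff) (smt (verit) mult_nonneg_nonneg of_nat_0_le_iff)
    next
      case False
      have "real M * 1 \<le> real M * s z" using s(6)[OF False] by (intro mult_left_mono) auto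
      moreover have "0 < e" using g(2) by linarith
      ultimately show ?thesis using B[OF z] M by (simp add: f_def)
    qed
    moreover have "\<phi> z - e < f z" if "z \<in> ?C \<inter> (W \<inter> U)" for z
      using in_U[of z] s(5)[of z] that by (simp add: f_def abs_less_iff)
    ultimately show ?thesis using s(2,3) U(1) xU by (intro exI[of _ f] exI[of _ "W \<inter> U"]) auto
  qed
  then have "\<forall>x\<in>?C. \<exists>f W. zpl f \<and> open W \<and> x \<in> W \<and> (\<forall>z\<in>?C. f z < \<phi> z + e) \<and> (\<forall>z\<in>?C \<inter> W. \<phi> z - e < f z)"
    by blast
  from bchoice[OF this] obtain f where "\<forall>x\<in>?C. \<exists>W. zpl (f x) \<and> open W \<and> x \<in> W \<and>
    (\<forall>z\<in>?C. f x z < \<phi> z + e) \<and> (\<forall>z\<in>?C \<inter> W. \<phi> z - e < f x z)" by blast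
  from bchoice[OF this] obtain W where W: "\<forall>x\<in>?C. zpl (f x) \<and> open (W x) \<and> x \<in> W x \<and>
    (\<forall>z\<in>?C. f x z < \<phi> z + e) \<and> (\<forall>z\<in>?C \<inter> W x. \<phi> z - e < f x z)" by blast
  have fW: "\<And>x. x \<in> ?C \<Longrightarrow> zpl (f x)" "\<And>x. x \<in> ?C \<Longrightarrow> open (W x)"
    "\<And>x. x \<in> ?C \<Longrightarrow> x \<in> W x" "\<And>x z. x \<in> ?C \<Longrightarrow> z \<in> ?C \<Longrightarrow> f x z < \<phi> z + e"
    "\<And>x z. x \<in> ?C \<Longrightarrow> z \<in> ?C \<Longrightarrow> z \<in> W x \<Longrightarrow> \<phi> z - e < f x z"
    using W by simp_all
  have "?C \<subseteq> \<Union>(W ` ?C)" using fW(3) by blast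
  then obtain T where T: "T \<subseteq> ?C" "finite T" "?C \<subseteq> \<Union>(W ` T)"
    using compactE_image[OF compact_cbox, of ?C W] fW(2) by metis
  have ne: "T \<noteq> {}"
  proof
    assume "T = {}"
    then have "(0::real^'n) \<notin> ?C" using T(3) by blast
    then show False by (simp add: mem_box_cart)
  qed
  define h where "h z = Max ((\<lambda>x. f x z) ` T)" for z
  have "zpl h" unfolding h_def using T ne fW(1) by (intro zpl_Max) auto
  moreover have "\<bar>h z - \<phi> z\<bar> < e" if z: "z \<in> ?C" for z
  proof -
    obtain x where x: "x \<in> T" "z \<in> W x" using T(3) z by blast
    have "f x z \<le> h z" unfolding h_def using T x by (intro Max_ge) auto
    moreover have "\<phi> z - e < f x z" using fW(5) x T(1) z by blast
    moreover have "h z < \<phi> z + e" unfolding h_def using T ne fW(4) z by (subst Max_less_iff) auto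
    ultimately show ?thesis by linarith
  qed
  ultimately show ?thesis by blast
qed

text \<open>\<open>f\<close> is clamped into the band of radius \<open>m * a\<close> around
  \<open>g\<close>. The result lies between \<open>f\<close> and \<open>g\<close>, which is enough
  where \<open>g\<close> is within \<open>e\<close> of \<phi>. On the compact rest \<open>a\<close>
  is positive, and a large \<open>m\<close> leaves \<open>f\<close> unchanged.\<close>

lemma zpl_approximation_rel:
  fixes \<phi> g a :: "real^'n \<Rightarrow> real"
  assumes \<phi>: "continuous_on (cbox 0 1) \<phi>"
    and f: "zpl f" "\<And>x. x \<in> cbox 0 1 \<Longrightarrow> \<bar>f x - \<phi> x\<bar> < e"
    and g: "zpl g" and a: "zpl a" "\<And>x. 0 \<le> a x"
    and eq: "\<And>x. x \<in> cbox 0 1 \<Longrightarrow> a x = 0 \<Longrightarrow> g x = \<phi> x"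
  shows "\<exists>h. zpl h \<and> (\<forall>x\<in>cbox 0 1. \<bar>h x - \<phi> x\<bar> < e) \<and> (\<forall>x. a x = 0 \<longrightarrow> h x = g x)"
proof -
  let ?C = "cbox 0 1 :: (real^'n) set"
  have "0 \<in> ?C" by (simp add: mem_box_cart)
  then have e: "e > 0" using f(2) by fastforce
  define Z where "Z = ?C \<inter> (\<lambda>x. \<bar>g x - \<phi> x\<bar>) -` {e..}"
  have "closed Z"
    unfolding Z_def using \<phi> continuous_zpl[OF g]
    by (intro continuous_closed_preimage continuous_on_rabs continuous_on_diff closed_cbox closed_atLeast)
  moreover have "bounded Z" unfolding Z_def by (intro bounded_subset[OF bounded_cbox Int_lower1])
  ultimately have "compact Z" by (simp add: compact_eq_bounded_closed)
  have aZ: "a x \<noteq> 0" if "x \<in> Z" for x using that eq e by (auto simp: Z_def)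
  have "continuous_on Z (\<lambda>x. \<bar>f x - g x\<bar> / a x)"
    using continuous_zpl[OF f(1)] continuous_zpl[OF g] continuous_zpl[OF a(1)] aZ
    by (intro continuous_on_divide continuous_on_rabs continuous_on_diff) auto
  then have "bounded ((\<lambda>x. \<bar>f x - g x\<bar> / a x) ` Z)"
    using \<open>compact Z\<close> compact_continuous_image compact_imp_bounded by blast
  then obtain B where B: "\<And>x. x \<in> Z \<Longrightarrow> \<bar>\<bar>f x - g x\<bar> / a x\<bar> \<le> B"
    unfolding bounded_real by blast
  obtain m :: nat where m: "B < real m" using reals_Archimedean2 by blast
  define h where "h x = min (max (f x) (g x - real m * a x)) (g x + real m * a x)" for x
  have "zpl h" unfolding h_def
    using f g a by (intro zpl_min zpl_max zpl_add zpl_diff zpl_of_nat_mult)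
  moreover have "\<bar>h x - \<phi> x\<bar> < e" if x: "x \<in> ?C" for x
  proof -
    have ma: "0 \<le> real m * a x" using a(2) by simp
    show ?thesis
    proof (cases "x \<in> Z")
      case True
      have "a x > 0" using aZ[OF True] a(2)[of x] by simp
      then have "\<bar>f x - g x\<bar> \<le> B * a x" using B[OF True] by (simp add: pos_divide_le_eq abs_of_nonneg)
      also have "\<dots> \<le> real m * a x" using m \<open>a x > 0\<close> by (intro mult_right_mono) auto
      finally have "h x = f x" by (auto simp: h_def)
      then show ?thesis using f(2)[OF x] by simp
    next
      case False
      then have "\<bar>g x - \<phi> x\<bar> < e" using x by (auto simp: Z_def)
      then show ?thesis using f(2)[OF x] ma by (auto simp: h_def min_def max_def abs_less_iff)
    qed
  qed
  moreover have "h x = g x" if "a x = 0" for x using that by (simp add: h_def)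
  ultimately show ?thesis by blast
qed

lemma ex_zpl_finite_zeros:
  fixes F :: "(real^'n) set"
  assumes "finite F" "F \<subseteq> low_den D"
  shows "\<exists>b. zpl b \<and> (\<forall>x. 0 \<le> b x) \<and> (\<forall>x. b x = 0 \<longleftrightarrow> x \<in> F)"
  using assms
proof (induction F)
  case empty
  show ?case by (intro exI[of _ "\<lambda>x. 1"]) (simp add: zpl_1)
next
  case (insert p F)
  then obtain b where b: "zpl b" "\<And>x. 0 \<le> b x" "\<And>x. b x = 0 \<longleftrightarrow> x \<in> F" by auto
  obtain d where d: "1 \<le> d" "\<And>i. real d * p $ i \<in> \<int>" using insert.prems by (auto simp: low_den_def)
  \<comment> \<open>Multiplication by \<open>d\<close> makes the constants integers.\<close>
  define c where "c x = (\<Sum>i\<in>UNIV. \<bar>real d * x $ i - real d * p $ i\<bar>)" for x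
  have "zpl c" unfolding c_def
    by (intro zpl_sum zpl_abs zpl_diff zpl_of_nat_mult zpl_coord zpl_Ints d)
  moreover have c0: "0 \<le> c x" for x unfolding c_def by (intro sum_nonneg) auto
  moreover have "c x = 0 \<longleftrightarrow> x = p" for x
    unfolding c_def using d(1) by (subst sum_nonneg_eq_0_iff) (auto simp: vec_eq_iff)
  ultimately show ?case
    using b(1,2)
  proof (intro exI[of _ "\<lambda>x. min (b x) (c x)"] conjI allI)
    show "min (b x) (c x) = 0 \<longleftrightarrow> x \<in> insert p F" for x
      using b(2,3)[of x] c0[of x] \<open>c x = 0 \<longleftrightarrow> x = p\<close> by (auto simp: min_def)
  qed (use b in \<open>auto intro: zpl_min\<close>)
qed

theorem AR_approximate_retraction:
  fixes P :: "(real^'n) set"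
  assumes P: "AR P" "closed P" "P \<subseteq> cbox 0 1"
    and a: "zpl a" "\<And>x. 0 \<le> a x" "\<And>x. x \<in> cbox 0 1 \<Longrightarrow> a x = 0 \<longleftrightarrow> x \<in> P"
    and v0: "v0 \<in> P" "\<And>i. v0 $ i \<in> \<int>" and e: "e > 0"
  shows "\<exists>\<rho> :: real^'n \<Rightarrow> real^'n. (\<forall>i. zpl (\<lambda>x. \<rho> x $ i)) \<and> (\<forall>x\<in>P. \<rho> x = x) \<and>
    (\<forall>x\<in>cbox 0 1. \<exists>p\<in>P. \<forall>i. \<bar>\<rho> x $ i - p $ i\<bar> < e)"
proof -
  let ?C = "cbox 0 1 :: (real^'n) set"
  obtain D :: nat where D: "D > 0" "1 / real D < e" using e by (meson nat_approx_posE zero_less_Suc)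
  define F where "F = low_den D - P"
  have finF: "finite F" unfolding F_def by (simp add: finite_low_den)
  have FC: "F \<subseteq> ?C" unfolding F_def low_den_def by auto
  obtain b where b: "zpl b" "\<And>x. 0 \<le> b x" "\<And>x. b x = 0 \<longleftrightarrow> x \<in> F"
    using ex_zpl_finite_zeros[of F D] finF by (auto simp: F_def)
  have clo: "closed (P \<union> F)" using P(2) finF by (simp add: finite_imp_closed closed_Un)
  \<comment> \<open>\<open>F\<close> is finite and disjoint from the closed set \<open>P\<close>, so
    the prescribed map is continuous and the absolute extensor property applies.\<close>
  have "continuous_on (P \<union> F) (\<lambda>x. if x \<in> P then x else v0)"
    by (intro continuous_on_cases P(2) finite_imp_closed finF continuous_on_id continuous_on_const)
      (auto simp: F_def)
  moreover have "(\<lambda>x. if x \<in> P then x else v0) ` (P \<union> F) \<subseteq> P" using v0 by auto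
  moreover have "closedin (top_of_set ?C) (P \<union> F)"
    using clo P(3) FC by (intro closed_subset) auto
  ultimately obtain \<phi> where \<phi>: "continuous_on ?C \<phi>" "\<phi> ` ?C \<subseteq> P"
    "\<And>x. x \<in> P \<union> F \<Longrightarrow> \<phi> x = (if x \<in> P then x else v0)"
    by (rule AR_imp_absolute_extensor[OF P(1)]) blast
  have "\<exists>h. zpl h \<and> (\<forall>x\<in>?C. \<bar>h x - \<phi> x $ i\<bar> < e) \<and> (\<forall>x\<in>P. h x = x $ i)" for i
  proof -
    \<comment> \<open>\<open>g\<close> has the exact values of \<phi> on \<open>P\<close> and on
      \<open>F\<close>, where arbitrary values cannot be approximated; the compatibility condition
      for gluing is vacuous.\<close>
    obtain g where g: "zpl g" "\<And>x. x \<in> ?C \<Longrightarrow> a x = 0 \<Longrightarrow> g x = x $ i" "\<And>x. x \<in> ?C \<Longrightarrow> b x = 0 \<Longrightarrow> g x = v0 $ i"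
      by (rule zpl_glue[OF zpl_coord zpl_Ints[OF v0(2)] a(1) b(1) a(2) b(2)]) (use a(3) b(3) in \<open>auto simp: F_def\<close>)
    have cont: "continuous_on ?C (\<lambda>x. \<phi> x $ i)" by (intro continuous_on_component \<phi>)
    have "\<exists>f. zpl f \<and> \<bar>f x - \<phi> x $ i\<bar> < e" if x: "x \<in> ?C" for x
    proof (cases "x \<in> P \<union> F")
      case True
      then have "g x = \<phi> x $ i" using g a(3)[OF x] b(3) \<phi>(3)[OF True] x by (auto simp: F_def)
      then show ?thesis using g(1) e by (intro exI[of _ g]) simp
    next
      case False
      then have "x \<notin> low_den D" by (simp add: F_def)
      then have "\<exists>i. real d * x $ i \<notin> \<int>" if "0 < d" "d \<le> D" for d
        using that x by (auto simp: low_den_def)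
      then show ?thesis using ex_approx_value[OF D(1), of x "\<phi> x $ i"] D(2) by (meson order_less_trans)
    qed
    from zpl_approximation[OF cont this] obtain f where f: "zpl f" "\<And>x. x \<in> ?C \<Longrightarrow> \<bar>f x - \<phi> x $ i\<bar> < e" by blast
    have "g x = \<phi> x $ i" if "x \<in> ?C" "a x = 0" for x
      using g(2)[OF that] \<phi>(3)[of x] a(3)[OF that(1)] that by simp
    from zpl_approximation_rel[OF cont f g(1) a(1,2) this]
    obtain h where h: "zpl h" "\<forall>x\<in>?C. \<bar>h x - \<phi> x $ i\<bar> < e" "\<forall>x. a x = 0 \<longrightarrow> h x = g x" by blast
    have "h x = x $ i" if "x \<in> P" for x
      using h(3) a(3)[of x] g(2)[of x] that P(3) by auto
    with h show ?thesis by blast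
  qed
  then have "\<forall>i. \<exists>h. zpl h \<and> (\<forall>x\<in>?C. \<bar>h x - \<phi> x $ i\<bar> < e) \<and> (\<forall>x\<in>P. h x = x $ i)" by blast
  from choice[OF this] obtain h where h: "\<And>i. zpl (h i)" "\<And>i x. x \<in> ?C \<Longrightarrow> \<bar>h i x - \<phi> x $ i\<bar> < e"
    "\<And>i x. x \<in> P \<Longrightarrow> h i x = x $ i" by blast
  show ?thesis
  proof (intro exI[of _ "\<lambda>x. \<chi> i. h i x"] conjI allI ballI)
    show "zpl (\<lambda>x. (\<chi> i. h i x) $ i)" for i using h(1)[of i] by simp
    show "(\<chi> i. h i x) = x" if "x \<in> P" for x using h(3)[OF that] by (simp add: vec_eq_iff)
    show "\<exists>p\<in>P. \<forall>i. \<bar>(\<chi> i. h i x) $ i - p $ i\<bar> < e" if "x \<in> ?C" for x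
      using h(2)[OF that] \<phi>(2) that by (intro bexI[of _ "\<phi> x"]) auto
  qed
qed

section \<open>Collapsible complexes are absolute retracts\<close>

lemma vertices_convex_hull: "\<not> affine_dependent C \<Longrightarrow> vertices (convex hull C) = C"
  by (auto simp: vertices_def extreme_point_of_convex_hull_affine_independent)

lemma convex_hull_vertices_unique:
  fixes C D :: "(real^'n) set"
  shows "\<not> affine_dependent C \<Longrightarrow> \<not> affine_dependent D \<Longrightarrow> convex hull C = convex hull D \<Longrightarrow> C = D"
  using vertices_convex_hull by metis

text \<open>\<open>free_face\<close> only excludes other simplexes of the dimension of
  \<open>T\<close>. If a coface of \<open>F\<close> has a further vertex \<open>b\<close>, then
  \<open>b\<close> and \<open>F\<close> span a face of that dimension, which must be
  \<open>T\<close>; so \<open>b\<close> is the vertex of \<open>T\<close> opposite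
  \<open>F\<close>.\<close>

lemma free_face_cofaces:
  fixes \<Gamma> :: "(real^'n) set set"
  assumes \<Gamma>: "simplicial_complex \<Gamma>" and free: "free_face \<Gamma> T F" and Y: "Y \<in> \<Gamma>" "F \<subseteq> Y"
  shows "Y = F \<or> Y = T"
proof -
  obtain m where T: "T \<in> \<Gamma>" "F facet_of T" "m simplex T"
    and uniq: "\<And>T'. T' \<in> \<Gamma> \<Longrightarrow> m simplex T' \<Longrightarrow> F face_of T' \<Longrightarrow> T' = T"
    using free unfolding free_face_def by blast
  obtain C where C: "\<not> affine_dependent C" "int (card C) = m + 1" "T = convex hull C"
    using T(3) unfolding simplex_def by blast
  obtain u where u: "u \<in> C" "F = convex hull (C - {u})"
    using T(2) unfolding C(3) facet_of_convex_hull_affine_independent[OF C(1)] by blast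
  have Cu: "\<not> affine_dependent (C - {u})" using C(1) affine_dependent_subset by blast
  have F: "F \<in> \<Gamma>" using \<Gamma> T facet_of_imp_face_of unfolding simplicial_complex_def by blast
  obtain k where "k simplex Y" using \<Gamma> Y unfolding simplicial_complex_def by blast
  then obtain D where D: "\<not> affine_dependent D" "Y = convex hull D" unfolding simplex_def by blast
  have "Y \<inter> F face_of Y" using \<Gamma> Y F unfolding simplicial_complex_def by blast
  then have "F face_of Y" using Y(2) by (simp add: Int_absorb1)
  then obtain E where E: "E \<subseteq> D" "F = convex hull E"
    using D face_of_convex_hull_affine_independent by blast
  have "\<not> affine_dependent E" using D(1) E(1) affine_dependent_subset by blast
  then have CD: "C - {u} \<subseteq> D" using convex_hull_vertices_unique[OF Cu] u(2) E by metis
  have "b = u" if b: "b \<in> D - (C - {u})" for b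
  proof -
    let ?T = "convex hull (insert b (C - {u}))"
    have ins: "insert b (C - {u}) \<subseteq> D" using b CD by blast
    then have ind: "\<not> affine_dependent (insert b (C - {u}))" using D(1) affine_dependent_subset by blast
    have "?T face_of Y" using D ins face_of_convex_hull_affine_independent by blast
    then have "?T \<in> \<Gamma>" using \<Gamma> Y unfolding simplicial_complex_def by blast
    moreover have "m simplex ?T"
    proof -
      have "finite C" using C(1) aff_independent_finite by blast
      then have "card (insert b (C - {u})) = card C"
        using b u(1) card_Suc_Diff1[of C u] by simp
      then show ?thesis using C(2) ind by (intro simplex_convex_hull) simp
    qed
    moreover have "F face_of ?T"
      using ind face_of_convex_hull_affine_independent u(2) by blast
    ultimately have "?T = T" by (rule uniq)
    then have "insert b (C - {u}) = C" using convex_hull_vertices_unique[OF ind C(1)] C(3) by simp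
    then show ?thesis using b by blast
  qed
  then have "D = C - {u} \<or> D = C" using CD u(1) by blast
  then show ?thesis using D(2) C(3) u(2) by blast
qed

text \<open>No remaining simplex contains \<open>F\<close>, so neither \<open>F\<close> nor
  \<open>T\<close> is a face of one.\<close>

lemma elementary_collapse_complex:
  fixes \<Gamma> :: "(real^'n) set set"
  assumes \<Gamma>: "simplicial_complex \<Gamma>" and "elementary_collapse \<Gamma> \<Delta>"
  shows "simplicial_complex \<Delta>"
proof -
  obtain T F where free: "free_face \<Gamma> T F" and \<Delta>: "\<Delta> = \<Gamma> - {T, F}"
    using assms(2) unfolding elementary_collapse_def by blast
  have FT: "F \<subseteq> T" using free facet_of_imp_subset unfolding free_face_def by blast
  have "G \<in> \<Delta>" if S: "S \<in> \<Delta>" and G: "G face_of S" for G S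
  proof -
    have "G \<in> \<Gamma>" using \<Gamma> S G unfolding \<Delta> simplicial_complex_def by blast
    moreover have "\<not> F \<subseteq> S" using free_face_cofaces[OF \<Gamma> free] S \<Delta> by blast
    then have "G \<noteq> T" "G \<noteq> F" using face_of_imp_subset[OF G] FT by blast+
    ultimately show ?thesis by (simp add: \<Delta>)
  qed
  then have "\<forall>G S. S \<in> \<Delta> \<and> G face_of S \<longrightarrow> G \<in> \<Delta>" by blast
  moreover have "finite \<Delta>" "\<forall>S\<in>\<Delta>. \<exists>n. n simplex S" "\<forall>S S'. S \<in> \<Delta> \<and> S' \<in> \<Delta> \<longrightarrow> S \<inter> S' face_of S"
    using \<Gamma> unfolding simplicial_complex_def \<Delta> by blast+
  ultimately show ?thesis unfolding simplicial_complex_def by blast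
qed

lemma closed_Union_complex: "simplicial_complex \<Gamma> \<Longrightarrow> closed (\<Union>\<Gamma>)"
  unfolding simplicial_complex_def by (intro closed_Union) (auto intro: closed_simplex)

text \<open>\<open>T\<close> meets the smaller complex in its faces other than \<open>T\<close> and
  \<open>F\<close>. Their union is starlike about the vertex \<open>u\<close> opposite
  \<open>F\<close>, as adding \<open>u\<close> to such a face gives another one.\<close>

lemma AR_elementary_expansion:
  fixes \<Gamma> :: "(real^'n) set set"
  assumes \<Gamma>: "simplicial_complex \<Gamma>" and coll: "elementary_collapse \<Gamma> \<Delta>" and AR: "AR (\<Union>\<Delta>)"
  shows "AR (\<Union>\<Gamma>)"
proof -
  obtain T F where free: "free_face \<Gamma> T F" and \<Delta>: "\<Delta> = \<Gamma> - {T, F}"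
    using coll unfolding elementary_collapse_def by blast
  obtain m where T: "T \<in> \<Gamma>" "F facet_of T" "m simplex T"
    using free unfolding free_face_def by blast
  obtain C where C: "\<not> affine_dependent C" "T = convex hull C"
    using T(3) unfolding simplex_def by blast
  have finC: "finite C" using C(1) aff_independent_finite by blast
  obtain u where u: "u \<in> C" "F = convex hull (C - {u})" and Fne: "F \<noteq> {}"
    using T(2) unfolding C(2) facet_of_convex_hull_affine_independent[OF C(1)] by blast
  have Cne: "C - {u} \<noteq> {}" using Fne u(2) by auto
  have ind: "\<not> affine_dependent D" if "D \<subseteq> C" for D using C(1) that affine_dependent_subset by blast
  have FT: "F \<subseteq> T" using T(2) facet_of_imp_subset by blast
  define \<B> where "\<B> = (\<lambda>D. convex hull D) ` {D. D \<subseteq> C \<and> D \<noteq> C \<and> D \<noteq> C - {u}}"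
  have Int: "\<Union>\<Delta> \<inter> T = \<Union>\<B>"
  proof (intro equalityI subsetI)
    fix x assume x: "x \<in> \<Union>\<Delta> \<inter> T"
    then obtain Y where Y: "Y \<in> \<Delta>" "x \<in> Y" by blast
    then have "T \<inter> Y face_of T" using \<Gamma> T unfolding \<Delta> simplicial_complex_def by blast
    then obtain D where D: "D \<subseteq> C" "T \<inter> Y = convex hull D"
      using face_of_convex_hull_affine_independent[OF C(1)] unfolding C(2) by blast
    have "\<not> F \<subseteq> Y" using free_face_cofaces[OF \<Gamma> free] Y \<Delta> by blast
    then have "T \<inter> Y \<noteq> T" "T \<inter> Y \<noteq> F" using FT by blast+
    then have "D \<noteq> C" "D \<noteq> C - {u}" using D(2) C(2) u(2) by auto
    then have "T \<inter> Y \<in> \<B>" using D by (auto simp: \<B>_def)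
    then show "x \<in> \<Union>\<B>" using x Y by blast
  next
    fix x assume "x \<in> \<Union>\<B>"
    then obtain D where D: "D \<subseteq> C" "D \<noteq> C" "D \<noteq> C - {u}" "x \<in> convex hull D" by (auto simp: \<B>_def)
    have "convex hull D face_of T" using D(1) face_of_convex_hull_affine_independent[OF C(1)] C(2) by blast
    then have "convex hull D \<in> \<Gamma>" "convex hull D \<subseteq> T"
      using \<Gamma> T face_of_imp_subset unfolding simplicial_complex_def by blast+
    moreover have "convex hull D \<noteq> T" "convex hull D \<noteq> F"
      using convex_hull_vertices_unique[OF ind[OF D(1)] ind] D C(2) u(2) by blast+
    ultimately show "x \<in> \<Union>\<Delta> \<inter> T" using D(4) \<Delta> by blast
  qed
  have "ANR (\<Union>\<B>)"
  proof (rule ANR_finite_Union_convex_closed)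
    show "finite \<B>" unfolding \<B>_def using finC by simp
    show "closed B" "convex B" if B: "B \<in> \<B>" for B
    proof -
      obtain D where D: "D \<subseteq> C" "B = convex hull D" using B unfolding \<B>_def by blast
      have "finite D" using D(1) finC finite_subset by blast
      then show "closed B" "convex B"
        unfolding D(2) by (simp_all add: compact_imp_closed finite_imp_compact_convex_hull)
    qed
  qed
  moreover have "starlike (\<Union>\<B>)"
    unfolding starlike_def
  proof (intro bexI[of _ u] ballI)
    have "{u} \<noteq> C" "{u} \<noteq> C - {u}" using Cne by auto
    then have "convex hull {u} \<in> \<B>" unfolding \<B>_def using u(1) by blast
    then show "u \<in> \<Union>\<B>" by force
    fix x assume "x \<in> \<Union>\<B>"
    then obtain D where D: "D \<subseteq> C" "D \<noteq> C" "D \<noteq> C - {u}" "x \<in> convex hull D" by (auto simp: \<B>_def)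
    have "insert u D \<subseteq> C" "insert u D \<noteq> C" "insert u D \<noteq> C - {u}" using D u(1) by auto
    then have "convex hull (insert u D) \<in> \<B>" unfolding \<B>_def by blast
    moreover have "x \<in> convex hull (insert u D)"
      using D(4) hull_mono[of D "insert u D"] by blast
    then have "closed_segment u x \<subseteq> convex hull (insert u D)"
      by (intro closed_segment_subset convex_convex_hull) (simp_all add: hull_inc)
    ultimately show "closed_segment u x \<subseteq> \<Union>\<B>" by blast
  qed
  then have "contractible (\<Union>\<B>)" "\<Union>\<B> \<noteq> {}"
    by (auto simp: starlike_imp_contractible) (auto simp: starlike_def)
  ultimately have "AR (\<Union>\<Delta> \<inter> T)" unfolding Int by (simp add: AR_ANR)
  moreover have "AR T" using convex_simplex[OF T(3)] FT Fne by (intro convex_imp_AR) auto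
  moreover have "closed (\<Union>\<Delta>)"
    using elementary_collapse_complex[OF \<Gamma> coll] by (rule closed_Union_complex)
  ultimately have "AR (\<Union>\<Delta> \<union> T)" using closed_simplex[OF T(3)] AR by (intro AR_closed_Un)
  moreover have "\<Union>\<Gamma> = \<Union>\<Delta> \<union> T" using T(1) FT unfolding \<Delta> by blast
  ultimately show ?thesis by simp
qed

lemma collapsible_imp_AR:
  fixes \<Gamma> :: "(real^'n) set set"
  assumes "simplicial_complex \<Gamma>" "collapsible \<Gamma>"
  shows "AR (\<Union>\<Gamma>)"
proof -
  obtain v where "elementary_collapse\<^sup>*\<^sup>* \<Gamma> {{}, {v}}"
    using assms(2) unfolding collapsible_def collapses_to_def by blast
  then have "simplicial_complex \<Gamma> \<longrightarrow> AR (\<Union>\<Gamma>)"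
  proof (induction rule: converse_rtranclp_induct)
    case base
    have "\<Union>{{}, {v}} = {v}" by simp
    then show ?case using convex_imp_AR[of "{v}"] by (simp only:) simp
  next
    case (step \<Gamma> \<Delta>)
    then show ?case using elementary_collapse_complex AR_elementary_expansion by blast
  qed
  then show ?thesis using assms(1) by blast
qed

section \<open>Regular triangulations\<close>

lemma convex_zero_set_int_affine: "int_affine l \<Longrightarrow> convex {x. l x = 0}"
  and convex_nonneg_set_int_affine: "int_affine l \<Longrightarrow> convex {x. 0 \<le> l x}"
proof -
  assume "int_affine l"
  then obtain m k where l: "l = (\<lambda>x. m \<bullet> x + k)" unfolding int_affine_def by blast
  have "{x. l x = 0} = {x. m \<bullet> x = - k}" "{x. 0 \<le> l x} = {x. m \<bullet> x \<ge> - k}" unfolding l by auto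
  then show "convex {x. l x = 0}" "convex {x. 0 \<le> l x}"
    by (simp_all add: convex_hyperplane convex_halfspace_ge)
qed

section \<open>Dual bases of the integer lattice\<close>

text \<open>For a basis \<open>B\<close>, these are the entries of the inverse of the matrix with
  columns in \<open>B\<close>.\<close>

definition dual_coord :: "(int^'k) set \<Rightarrow> int^'k \<Rightarrow> 'k \<Rightarrow> int" where
  "dual_coord B b k = int_vec.representation B (axis k 1) b"

context
  fixes B :: "(int^'k) set"
  assumes B: "Z_basis B"
begin

lemma Z_basis_independent: "int_vec.independent B" and Z_basis_span: "w \<in> int_vec.span B"
  using B by (auto simp: Z_basis_def)

lemma representation_dual_coord: "int_vec.representation B w b = (\<Sum>k\<in>UNIV. w $ k * dual_coord B b k)"
proof -
  have "w = (\<Sum>k\<in>UNIV. w $ k *s axis k 1)"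
    by (simp add: vec_eq_iff axis_def if_distrib sum.delta cong: if_cong)
  then have "int_vec.representation B w b = int_vec.representation B (\<Sum>k\<in>UNIV. w $ k *s axis k 1) b"
    by simp
  also have "\<dots> = (\<Sum>k\<in>UNIV. int_vec.representation B (w $ k *s axis k 1) b)"
    by (simp add: int_vec.representation_sum[OF Z_basis_independent Z_basis_span])
  also have "\<dots> = (\<Sum>k\<in>UNIV. w $ k * dual_coord B b k)"
    by (simp add: int_vec.representation_scale[OF Z_basis_independent Z_basis_span] dual_coord_def)
  finally show ?thesis .
qed

text \<open>Each \<open>b\<close> has coordinate 1 with respect to itself, so it occurs in the
  expansion of some unit vector, and there are finitely many of these.\<close>

lemma finite_Z_basis: "finite B"
proof (rule finite_subset)
  show "B \<subseteq> (\<Union>k. {b. dual_coord B b k \<noteq> 0})"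
  proof
    fix b assume b: "b \<in> B"
    have "(\<Sum>k\<in>UNIV. b $ k * dual_coord B b k) = 1"
      unfolding representation_dual_coord[symmetric]
      by (simp add: int_vec.representation_basis[OF Z_basis_independent b])
    then obtain k where "dual_coord B b k \<noteq> 0" by (force intro: sum.neutral)
    then show "b \<in> (\<Union>k. {b. dual_coord B b k \<noteq> 0})" by blast
  qed
  show "finite (\<Union>k. {b. dual_coord B b k \<noteq> 0})"
    unfolding dual_coord_def using int_vec.finite_representation by auto
qed

lemma sum_dual_coord: "(\<Sum>b\<in>B. dual_coord B b k * b $ j) = (if j = k then 1 else 0)"
proof -
  have "(\<Sum>b\<in>B. int_vec.representation B (axis k 1) b *s b) = axis k 1"
    by (rule int_vec.sum_representation_eq[OF Z_basis_independent Z_basis_span finite_Z_basis order_refl])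
  then have "(\<Sum>b\<in>B. int_vec.representation B (axis k 1) b *s b) $ j = axis k 1 $ j" by simp
  then show ?thesis by (simp add: dual_coord_def axis_def)
qed

end

text \<open>For a basis \<open>B\<close>, the coordinate functional of \<open>b\<close> at the
  vector \<open>(x, 1)\<close>.\<close>

definition dual_affine :: "(int^('n option)) set \<Rightarrow> int^('n option) \<Rightarrow> real^'n \<Rightarrow> real" where
  "dual_affine B b x = (\<Sum>i\<in>UNIV. of_int (dual_coord B b (Some i)) * x $ i) + of_int (dual_coord B b None)"

lemma int_affine_dual_affine: "int_affine (dual_affine B b)"
  unfolding int_affine_def dual_affine_def
  by (intro exI[of _ "\<chi> i. of_int (dual_coord B b (Some i))"] exI[of _ "of_int (dual_coord B b None)"])
    (auto simp: inner_vec_def)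

lemma sum_option: "(\<Sum>k\<in>(UNIV :: 'n::finite option set). f k) = (\<Sum>i\<in>UNIV. f (Some i)) + f None"
proof -
  have "(\<Sum>k\<in>UNIV. f k) = (\<Sum>k\<in>insert None (range Some). f k)" by (simp add: UNIV_option_conv)
  also have "\<dots> = f None + (\<Sum>k\<in>range Some. f k)" by (intro sum.insert) auto
  also have "(\<Sum>k\<in>range Some. f k) = (\<Sum>i\<in>UNIV. f (Some i))" by (simp add: sum.reindex)
  finally show ?thesis by (simp add: add.commute)
qed

lemma homogeneous_None: "homogeneous v $ None = int (den v)"
  by (simp add: homogeneous_def)

lemma dual_affine_rational:
  assumes "Z_basis B" "rational_point v"
  shows "real (den v) * dual_affine B b v = of_int (int_vec.representation B (homogeneous v) b)"
  unfolding representation_dual_coord[OF assms(1)] sum_option dual_affine_def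
  by (simp add: homogeneous_None homogeneous_Some[OF assms(2)] sum_distrib_left algebra_simps)

text \<open>The expansion of \<open>(x, 1)\<close> in the basis \<open>B\<close>, read off in each
  coordinate.\<close>

lemma sum_dual_affine:
  assumes B: "Z_basis B"
  shows "(\<Sum>b\<in>B. dual_affine B b x * of_int (b $ Some i)) = x $ i"
    and "(\<Sum>b\<in>B. dual_affine B b x * of_int (b $ None)) = 1"
proof -
  have *: "(\<Sum>b\<in>B. dual_affine B b x * of_int (b $ j)) =
      (\<Sum>i\<in>UNIV. (if j = Some i then 1 else 0) * x $ i) + (if j = None then 1 else 0)" for j
  proof -
    have **: "(\<Sum>b\<in>B. of_int (dual_coord B b k) * of_int (b $ j)) = (if j = k then 1 else 0 :: real)" for k
      using arg_cong[OF sum_dual_coord[OF B, of k j], of real_of_int] by simp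
    have "(\<Sum>b\<in>B. dual_affine B b x * of_int (b $ j)) =
      (\<Sum>b\<in>B. \<Sum>i\<in>UNIV. (of_int (dual_coord B b (Some i)) * of_int (b $ j)) * x $ i)
      + (\<Sum>b\<in>B. of_int (dual_coord B b None) * of_int (b $ j))"
      by (simp add: dual_affine_def distrib_right sum.distrib sum_distrib_right)
        (simp add: sum_distrib_left algebra_simps)
    also have "(\<Sum>b\<in>B. \<Sum>i\<in>UNIV. (of_int (dual_coord B b (Some i)) * of_int (b $ j)) * x $ i)
      = (\<Sum>i\<in>UNIV. (\<Sum>b\<in>B. of_int (dual_coord B b (Some i)) * of_int (b $ j)) * x $ i)"
      unfolding sum_distrib_right by (rule sum.swap)
    finally show ?thesis unfolding ** .
  qed
  show "(\<Sum>b\<in>B. dual_affine B b x * of_int (b $ Some i)) = x $ i"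
  proof -
    have "(\<Sum>k\<in>UNIV. (if Some i = Some k then 1 else 0) * x $ k) = (\<Sum>k\<in>UNIV. if i = k then x $ k else 0)"
      by (intro sum.cong) auto
    then show ?thesis unfolding * by simp
  qed
  show "(\<Sum>b\<in>B. dual_affine B b x * of_int (b $ None)) = 1" unfolding * by simp
qed

section \<open>Coordinates and hats\<close>

lemma homogeneous_inject:
  assumes "rational_point v" "rational_point w" "homogeneous v = homogeneous w"
  shows "v = w"
proof -
  have d: "den v = den w" using assms(3) homogeneous_None by (metis of_nat_eq_iff)
  have "real (den v) * v $ i = real (den w) * w $ i" for i
    using homogeneous_Some[OF assms(1)] homogeneous_Some[OF assms(2)] assms(3) by metis
  then show ?thesis using d den_works(1)[OF assms(1)] by (simp add: vec_eq_iff)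
qed

lemma regular_simplex_convex_hull:
  assumes "regular_simplex S"
  shows "\<not> affine_dependent (vertices S)" "S = convex hull (vertices S)" "finite (vertices S)"
proof -
  obtain C where "\<not> affine_dependent C" "S = convex hull C"
    using assms unfolding regular_simplex_def simplex_def by blast
  moreover from this have "vertices S = C" by (simp add: vertices_convex_hull)
  ultimately show "\<not> affine_dependent (vertices S)" "S = convex hull (vertices S)" "finite (vertices S)"
    using aff_independent_finite by auto
qed

text \<open>The coordinates dual to a basis of the integer lattice that extends the homogeneous
  vertices are, up to the factors \<^term>\<open>den v\<close>, the barycentric ones.\<close>

lemma regular_simplex_coordinates:
  assumes S: "regular_simplex S"
  shows "\<exists>L a. (\<forall>v. int_affine (L v)) \<and> zpl a \<and> (\<forall>x. 0 \<le> a x) \<and> (\<forall>x. a x = 0 \<longleftrightarrow> x \<in> S) \<and>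
    (\<forall>v\<in>vertices S. \<forall>w\<in>vertices S. real (den v) * L v w = (if v = w then 1 else 0)) \<and>
    (\<forall>x\<in>S. (\<forall>v\<in>vertices S. 0 \<le> L v x) \<and> (\<Sum>v\<in>vertices S. real (den v) * L v x) = 1 \<and>
       (\<Sum>v\<in>vertices S. (real (den v) * L v x) *\<^sub>R v) = x)"
proof -
  define V where "V = vertices S"
  have hull: "S = convex hull V" "finite V" using regular_simplex_convex_hull[OF S] by (simp_all add: V_def)
  have rat: "rational_point v" if "v \<in> V" for v using S that by (simp add: regular_simplex_def V_def)
  obtain B where B: "Z_basis B" "homogeneous ` V \<subseteq> B" using S unfolding regular_simplex_def V_def by blast
  have finB: "finite B" using finite_Z_basis[OF B(1)] .
  let ?A = "dual_affine B"
  let ?H = "homogeneous ` V"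
  have inj: "inj_on homogeneous V" using homogeneous_inject rat by (auto intro!: inj_onI)
  have Av: "real (den v) * ?A b v = (if homogeneous v = b then 1 else 0)" if "v \<in> V" "b \<in> B" for v b
  proof -
    have "homogeneous v \<in> B" using B(2) that by blast
    then have "int_vec.representation B (homogeneous v) = (\<lambda>c. if c = homogeneous v then 1 else 0)"
      by (intro int_vec.representation_basis Z_basis_independent B)
    then show ?thesis using dual_affine_rational[OF B(1) rat[OF that(1)], of b] by simp
  qed
  \<comment> \<open>A description of \<open>S\<close> by integral equations and inequalities:
    \<open>S\<close> lies in the convex set \<open>Q\<close> because its vertices do, and the
    coordinates exhibit each point of \<open>Q\<close> as a convex combination of vertices.\<close>
  define Q where "Q = {x. \<forall>b\<in>B. if b \<in> ?H then 0 \<le> ?A b x else ?A b x = 0}"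
  have "V \<subseteq> Q"
  proof
    fix v assume v: "v \<in> V"
    have d: "real (den v) > 0" using den_works(1)[OF rat[OF v]] by simp
    have "if b \<in> ?H then 0 \<le> ?A b v else ?A b v = 0" if b: "b \<in> B" for b
    proof (cases "homogeneous v = b")
      case True
      then have "real (den v) * ?A b v = 1" using Av[OF v b] by simp
      then have "0 \<le> ?A b v" using d by (metis zero_le_one zero_le_mult_iff not_less order_less_imp_le)
      then show ?thesis using True v by auto
    next
      case False
      then have "?A b v = 0" using Av[OF v b] d by simp
      then show ?thesis by simp
    qed
    then show "v \<in> Q" by (simp add: Q_def)
  qed
  moreover have "convex Q"
  proof -
    have "Q = (\<Inter>b\<in>B. if b \<in> ?H then {x. 0 \<le> ?A b x} else {x. ?A b x = 0})"
      by (auto simp: Q_def split: if_splits)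
    moreover have "convex (if b \<in> ?H then {x. 0 \<le> ?A b x} else {x. ?A b x = 0})" for b
      using convex_zero_set_int_affine[OF int_affine_dual_affine] convex_nonneg_set_int_affine[OF int_affine_dual_affine]
      by (cases "b \<in> ?H") simp_all
    ultimately show ?thesis by (simp only:) (intro convex_INT)
  qed
  ultimately have SQ: "S \<subseteq> Q" unfolding hull(1) by (rule hull_minimal)
  have Q: "(\<Sum>v\<in>V. real (den v) * ?A (homogeneous v) x) = 1"
    "(\<Sum>v\<in>V. (real (den v) * ?A (homogeneous v) x) *\<^sub>R v) = x"
    "\<And>v. v \<in> V \<Longrightarrow> 0 \<le> ?A (homogeneous v) x" if x: "x \<in> Q" for x
  proof -
    have sum: "(\<Sum>b\<in>B. ?A b x * of_int (b $ j)) = (\<Sum>v\<in>V. ?A (homogeneous v) x * of_int (homogeneous v $ j))" for j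
    proof -
      have "(\<Sum>b\<in>B. ?A b x * of_int (b $ j)) = (\<Sum>b\<in>?H. ?A b x * of_int (b $ j))"
        using x finB B(2) by (intro sum.mono_neutral_right) (auto simp: Q_def)
      then show ?thesis by (simp add: sum.reindex[OF inj])
    qed
    show "(\<Sum>v\<in>V. real (den v) * ?A (homogeneous v) x) = 1"
      using sum[of None] sum_dual_affine(2)[OF B(1), of x] by (simp add: homogeneous_None mult.commute)
    have "(\<Sum>v\<in>V. real (den v) * ?A (homogeneous v) x * v $ i) = x $ i" for i
    proof -
      have "x $ i = (\<Sum>v\<in>V. ?A (homogeneous v) x * of_int (homogeneous v $ Some i))"
        using sum[of "Some i"] sum_dual_affine(1)[OF B(1), of x i] by simp
      also have "\<dots> = (\<Sum>v\<in>V. real (den v) * ?A (homogeneous v) x * v $ i)"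
        using homogeneous_Some[OF rat] by (intro sum.cong) (auto simp: algebra_simps)
      finally show ?thesis by simp
    qed
    then show "(\<Sum>v\<in>V. (real (den v) * ?A (homogeneous v) x) *\<^sub>R v) = x" by (simp add: vec_eq_iff)
    show "0 \<le> ?A (homogeneous v) x" if "v \<in> V" for v
    proof -
      have "homogeneous v \<in> B" "homogeneous v \<in> ?H" using B(2) that by auto
      then show ?thesis using x by (auto simp: Q_def)
    qed
  qed
  have QS: "Q \<subseteq> S"
  proof
    fix x assume x: "x \<in> Q"
    have "(\<Sum>v\<in>V. (real (den v) * ?A (homogeneous v) x) *\<^sub>R v) \<in> convex hull V"
      using Q[OF x] hull(2) by (intro convex_sum) (auto simp: hull_inc)
    then show "x \<in> S" using Q(2)[OF x] hull(1) by simp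
  qed
  define a where "a x = (\<Sum>b\<in>B. if b \<in> ?H then max 0 (- ?A b x) else \<bar>?A b x\<bar>)" for x
  have "zpl a" unfolding a_def
  proof (rule zpl_sum)
    fix b
    have "zpl (?A b)" by (intro zpl_int_affine int_affine_dual_affine)
    then show "zpl (\<lambda>x. if b \<in> ?H then max 0 (- ?A b x) else \<bar>?A b x\<bar>)"
      by (cases "b \<in> ?H") (simp_all add: zpl_max zpl_0 zpl_minus zpl_abs)
  qed
  moreover have "0 \<le> a x" for x unfolding a_def by (intro sum_nonneg) auto
  moreover have "a x = 0 \<longleftrightarrow> x \<in> S" for x
  proof -
    have "a x = 0 \<longleftrightarrow> (\<forall>b\<in>B. (if b \<in> ?H then max 0 (- ?A b x) else \<bar>?A b x\<bar>) = 0)"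
      unfolding a_def using finB by (intro sum_nonneg_eq_0_iff) auto
    also have "\<dots> \<longleftrightarrow> x \<in> Q" by (auto simp: Q_def max_def split: if_splits)
    finally show ?thesis using SQ QS by blast
  qed
  moreover have "real (den v) * ?A (homogeneous v) w = (if v = w then 1 else 0)" if "v \<in> V" "w \<in> V" for v w
  proof (cases "v = w")
    case True
    then show ?thesis using Av[of v "homogeneous v"] B(2) that by auto
  next
    case False
    then have "homogeneous w \<noteq> homogeneous v" using inj that by (auto dest: inj_onD)
    then have "real (den w) * ?A (homogeneous v) w = 0" using Av[of w "homogeneous v"] B(2) that by auto
    then show ?thesis using False den_works(1)[OF rat[OF that(2)]] by simp
  qed
  ultimately show ?thesis
    using Q SQ unfolding V_def[symmetric]
    by (intro exI[of _ "\<lambda>v. ?A (homogeneous v)"] exI[of _ a]) (simp add: subset_iff int_affine_dual_affine)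
qed

lemma vertices_face:
  assumes "\<not> affine_dependent (vertices S)" "S = convex hull (vertices S)" "F face_of S"
  shows "vertices F \<subseteq> vertices S" "F = convex hull (vertices F)"
proof -
  obtain C where C: "C \<subseteq> vertices S" "F = convex hull C"
    using assms face_of_convex_hull_affine_independent by metis
  then have "\<not> affine_dependent C" using assms(1) affine_dependent_subset by blast
  then have "vertices F = C" using C(2) by (simp add: vertices_convex_hull)
  then show "vertices F \<subseteq> vertices S" "F = convex hull (vertices F)" using C by auto
qed

text \<open>The functions \<open>h v\<close> are the Schauder hats of the triangulation, scaled to take the value
  \<open>1 / den v\<close> at the vertex \<open>v\<close>.\<close>

lemma regular_complex_hats:
  fixes \<Delta> :: "(real^'n) set set"
  assumes sc: "simplicial_complex \<Delta>" and reg: "regular \<Delta>"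
  shows "\<exists>h. (\<forall>v. zpl (h v)) \<and> (\<forall>T\<in>\<Delta>. \<forall>x\<in>T.
      (\<forall>v. v \<notin> vertices T \<longrightarrow> h v x = 0) \<and> (\<forall>v\<in>vertices T. 0 \<le> h v x) \<and>
      (\<Sum>v\<in>vertices T. real (den v) * h v x) = 1 \<and>
      (\<Sum>v\<in>vertices T. (real (den v) * h v x) *\<^sub>R v) = x)"
    and "\<exists>a. zpl a \<and> (\<forall>x. 0 \<le> a x) \<and> (\<forall>x. a x = 0 \<longleftrightarrow> x \<in> \<Union>\<Delta>)"
proof -
  have regT: "regular_simplex T" if "T \<in> \<Delta>" for T using reg that by (simp add: regular_def)
  note hull = regular_simplex_convex_hull[OF regT]
  have "\<forall>T\<in>\<Delta>. \<exists>L a. (\<forall>v. int_affine (L v)) \<and> zpl a \<and> (\<forall>x. 0 \<le> a x) \<and> (\<forall>x. a x = 0 \<longleftrightarrow> x \<in> T) \<and>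
    (\<forall>v\<in>vertices T. \<forall>w\<in>vertices T. real (den v) * L v w = (if v = w then 1 else 0)) \<and>
    (\<forall>x\<in>T. (\<forall>v\<in>vertices T. 0 \<le> L v x) \<and> (\<Sum>v\<in>vertices T. real (den v) * L v x) = 1 \<and>
       (\<Sum>v\<in>vertices T. (real (den v) * L v x) *\<^sub>R v) = x)"
    using regular_simplex_coordinates[OF regT] by blast
  from bchoice[OF this] obtain L where "\<forall>T\<in>\<Delta>. \<exists>a. (\<forall>v. int_affine (L T v)) \<and> zpl a \<and> (\<forall>x. 0 \<le> a x) \<and> (\<forall>x. a x = 0 \<longleftrightarrow> x \<in> T) \<and>
    (\<forall>v\<in>vertices T. \<forall>w\<in>vertices T. real (den v) * L T v w = (if v = w then 1 else 0)) \<and>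
    (\<forall>x\<in>T. (\<forall>v\<in>vertices T. 0 \<le> L T v x) \<and> (\<Sum>v\<in>vertices T. real (den v) * L T v x) = 1 \<and>
       (\<Sum>v\<in>vertices T. (real (den v) * L T v x) *\<^sub>R v) = x)" by blast
  from bchoice[OF this] obtain a where La: "\<forall>T\<in>\<Delta>. (\<forall>v. int_affine (L T v)) \<and> zpl (a T) \<and> (\<forall>x. 0 \<le> a T x) \<and> (\<forall>x. a T x = 0 \<longleftrightarrow> x \<in> T) \<and>
    (\<forall>v\<in>vertices T. \<forall>w\<in>vertices T. real (den v) * L T v w = (if v = w then 1 else 0)) \<and>
    (\<forall>x\<in>T. (\<forall>v\<in>vertices T. 0 \<le> L T v x) \<and> (\<Sum>v\<in>vertices T. real (den v) * L T v x) = 1 \<and>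
       (\<Sum>v\<in>vertices T. (real (den v) * L T v x) *\<^sub>R v) = x)" by blast
  \<comment> \<open>Extension by 0 also covers a vertex that belongs to only one of two intersecting
    simplexes.\<close>
  define H where "H T v = (if v \<in> vertices T then L T v else (\<lambda>x. 0))" for T v
  have H_aff: "int_affine (H T v)" if "T \<in> \<Delta>" for T v
  proof (cases "v \<in> vertices T")
    case False
    have "int_affine (\<lambda>x::real^'n. 0)"
      unfolding int_affine_def by (intro exI[of _ 0]) auto
    then show ?thesis using False by (simp add: H_def)
  qed (use La that in \<open>simp add: H_def\<close>)
  have rat: "rational_point v" if "T \<in> \<Delta>" "v \<in> vertices T" for T v
    using regT[OF that(1)] that(2) by (simp add: regular_simplex_def)
  have H_vertex: "H T v w = (if v = w then 1 / real (den v) else 0)" if "T \<in> \<Delta>" "w \<in> vertices T" for T v w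
  proof (cases "v \<in> vertices T")
    case True
    then have "real (den v) * H T v w = (if v = w then 1 else 0)" using La that by (simp add: H_def)
    moreover have "real (den v) > 0" using den_works(1)[OF rat[OF that(1) True]] by simp
    ultimately show ?thesis by (simp add: field_simps split: if_splits)
  next
    case False
    then show ?thesis using that by (auto simp: H_def)
  qed
  \<comment> \<open>On the common face both functions are affine, and they agree at its
    vertices.\<close>
  have agree: "H T v x = H T' v x" if T: "T \<in> \<Delta>" "x \<in> T" and T': "T' \<in> \<Delta>" "x \<in> T'" for T T' v x
  proof -
    have "T \<inter> T' face_of T" "T' \<inter> T face_of T'" using sc T T' unfolding simplicial_complex_def by blast+
    then have f: "T \<inter> T' face_of T" "T \<inter> T' face_of T'" by (simp_all add: Int_commute)
    define C where "C = vertices (T \<inter> T')"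
    have C: "C \<subseteq> vertices T" "C \<subseteq> vertices T'" "T \<inter> T' = convex hull C"
      using vertices_face[OF hull(1,2)[OF T(1)] f(1)] vertices_face[OF hull(1,2)[OF T'(1)] f(2)]
      by (simp_all add: C_def)
    have "C \<subseteq> {x. H T v x - H T' v x = 0}"
    proof
      fix w assume "w \<in> C"
      then have "w \<in> vertices T" "w \<in> vertices T'" using C by blast+
      then show "w \<in> {x. H T v x - H T' v x = 0}"
        using H_vertex[OF T(1), of w v] H_vertex[OF T'(1), of w v] by simp
    qed
    then have "convex hull C \<subseteq> {x. H T v x - H T' v x = 0}"
      by (intro hull_minimal convex_zero_set_int_affine int_affine_diff H_aff T T')
    then show ?thesis using T T' C(3) by auto
  qed
  define \<phi> where "\<phi> v x = H (SOME T. T \<in> \<Delta> \<and> x \<in> T) v x" for v x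
  have \<phi>: "\<phi> v x = H T v x" if "T \<in> \<Delta>" "x \<in> T" for T v x
  proof -
    have "(SOME T. T \<in> \<Delta> \<and> x \<in> T) \<in> \<Delta> \<and> x \<in> (SOME T. T \<in> \<Delta> \<and> x \<in> T)"
      by (rule someI[of "\<lambda>T. T \<in> \<Delta> \<and> x \<in> T" T]) (use that in simp)
    then show ?thesis unfolding \<phi>_def using agree that by blast
  qed
  have "finite \<Delta>" using sc by (simp add: simplicial_complex_def)
  \<comment> \<open>Simplexes are added one at a time; the function \<open>b\<close> cutting out the
    union so far is what the next application of \<open>zpl_glue\<close> requires.\<close>
  have glue: "\<exists>h b. zpl h \<and> zpl b \<and> (\<forall>x. 0 \<le> b x) \<and> (\<forall>x. b x = 0 \<longleftrightarrow> x \<in> \<Union>\<D>) \<and>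
      (\<forall>x\<in>cbox 0 1. x \<in> \<Union>\<D> \<longrightarrow> h x = \<phi> v x)" if "\<D> \<subseteq> \<Delta>" for \<D> v
    using finite_subset[OF that \<open>finite \<Delta>\<close>] that
  proof (induction \<D>)
    case empty
    show ?case by (rule exI[of _ "\<lambda>x. 0"], rule exI[of _ "\<lambda>x. 1"]) (simp add: zpl_0 zpl_1)
  next
    case (insert T \<D>)
    then obtain h b where hb: "zpl h" "zpl b" "\<And>x. 0 \<le> b x" "\<And>x. b x = 0 \<longleftrightarrow> x \<in> \<Union>\<D>"
      "\<And>x. x \<in> cbox 0 1 \<Longrightarrow> x \<in> \<Union>\<D> \<Longrightarrow> h x = \<phi> v x" by auto
    have T: "T \<in> \<Delta>" using insert.prems by simp
    have aT: "zpl (a T)" "\<And>x. 0 \<le> a T x" "\<And>x. a T x = 0 \<longleftrightarrow> x \<in> T" using La T by simp_all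
    obtain g where g: "zpl g" "\<And>x. x \<in> cbox 0 1 \<Longrightarrow> b x = 0 \<Longrightarrow> g x = h x"
      "\<And>x. x \<in> cbox 0 1 \<Longrightarrow> a T x = 0 \<Longrightarrow> g x = H T v x"
      by (rule zpl_glue[OF hb(1) zpl_int_affine[OF H_aff[OF T]] hb(2) aT(1) hb(3) aT(2)])
        (use hb(4,5) aT(3) \<phi>[OF T] in auto)
    show ?case
    proof (rule exI[of _ g], rule exI[of _ "\<lambda>x. min (b x) (a T x)"], intro conjI allI ballI impI)
      show "min (b x) (a T x) = 0 \<longleftrightarrow> x \<in> \<Union>(insert T \<D>)" for x
        using hb(3,4)[of x] aT(2,3)[of x] by (auto simp: min_def)
      show "g x = \<phi> v x" if "x \<in> cbox 0 1" "x \<in> \<Union>(insert T \<D>)" for x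
        using that g(2,3)[of x] hb(4,5)[of x] aT(3)[of x] \<phi>[OF T, of x v] by auto
    qed (use g hb aT in \<open>auto intro: zpl_min\<close>)
  qed
  have P: "T \<subseteq> cbox 0 1" if "T \<in> \<Delta>" for T using regT[OF that] by (simp add: regular_simplex_def)
  have "\<exists>h. zpl h \<and> (\<forall>x\<in>\<Union>\<Delta>. h x = \<phi> v x)" for v
    using glue[of \<Delta> v] P by blast
  then have "\<forall>v. \<exists>h. zpl h \<and> (\<forall>x\<in>\<Union>\<Delta>. h x = \<phi> v x)" by blast
  from choice[OF this] obtain h where h: "\<forall>v. zpl (h v) \<and> (\<forall>x\<in>\<Union>\<Delta>. h v x = \<phi> v x)" by blast
  have hH: "h v x = H T v x" if "T \<in> \<Delta>" "x \<in> T" for T v x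
    using h \<phi>[OF that] that by auto
  show "\<exists>a. zpl a \<and> (\<forall>x. 0 \<le> a x) \<and> (\<forall>x. a x = 0 \<longleftrightarrow> x \<in> \<Union>\<Delta>)"
    using glue[of \<Delta>] by blast
  have LT: "(\<forall>v\<in>vertices T. 0 \<le> L T v x) \<and> (\<Sum>v\<in>vertices T. real (den v) * L T v x) = 1 \<and>
       (\<Sum>v\<in>vertices T. (real (den v) * L T v x) *\<^sub>R v) = x" if "T \<in> \<Delta>" "x \<in> T" for T x
    using La that by blast
  show "\<exists>h. (\<forall>v. zpl (h v)) \<and> (\<forall>T\<in>\<Delta>. \<forall>x\<in>T.
      (\<forall>v. v \<notin> vertices T \<longrightarrow> h v x = 0) \<and> (\<forall>v\<in>vertices T. 0 \<le> h v x) \<and>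
      (\<Sum>v\<in>vertices T. real (den v) * h v x) = 1 \<and>
      (\<Sum>v\<in>vertices T. (real (den v) * h v x) *\<^sub>R v) = x)"
  proof (intro exI[of _ h] conjI ballI)
    show "\<forall>v. zpl (h v)" using h by blast
    fix T x assume T: "T \<in> \<Delta>" "x \<in> T"
    show "\<forall>v. v \<notin> vertices T \<longrightarrow> h v x = 0" using hH[OF T] by (simp add: H_def)
    show "0 \<le> h v x" if "v \<in> vertices T" for v using hH[OF T] LT[OF T] that by (simp add: H_def)
    show "(\<Sum>v\<in>vertices T. real (den v) * h v x) = 1"
      using LT[OF T] hH[OF T] by (simp add: H_def)
    show "(\<Sum>v\<in>vertices T. (real (den v) * h v x) *\<^sub>R v) = x"
      using LT[OF T] hH[OF T] by (simp add: H_def)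
  qed
qed

section \<open>Strong regularity and the neighbourhood retraction\<close>

lemma weighted_complex_strongly_regular:
  fixes \<Delta> :: "(real^'n) set set"
  assumes sc: "simplicial_complex \<Delta>" and sreg: "strongly_regular \<Delta>" and ne: "\<Delta> \<noteq> {}"
  shows "weighted_complex (\<Union>(vertices ` \<Delta>)) (vertices ` \<Delta>) den"
proof
  have regT: "regular_simplex T" if "T \<in> \<Delta>" for T
    using sreg that by (simp add: strongly_regular_def regular_def)
  note hull = regular_simplex_convex_hull[OF regT]
  have fin: "finite \<Delta>" using sc by (simp add: simplicial_complex_def)
  show "finite (\<Union>(vertices ` \<Delta>))" using fin hull(3) by auto
  show "S \<subseteq> \<Union>(vertices ` \<Delta>)" if "S \<in> vertices ` \<Delta>" for S using that by blast
  show down: "D \<in> vertices ` \<Delta>" if S: "S \<in> vertices ` \<Delta>" and "D \<subseteq> S" for S D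
  proof -
    obtain T where T: "T \<in> \<Delta>" "S = vertices T" using S by blast
    have "convex hull D face_of T"
      using face_of_convex_hull_affine_independent[OF hull(1)[OF T(1)]] hull(2)[OF T(1)] T(2) \<open>D \<subseteq> S\<close> by metis
    then have "convex hull D \<in> \<Delta>" using sc T(1) unfolding simplicial_complex_def by blast
    moreover have "vertices (convex hull D) = D"
      using affine_dependent_subset[of D S] \<open>D \<subseteq> S\<close> hull(1)[OF T(1)] T(2) by (intro vertices_convex_hull) blast
    ultimately show ?thesis by force
  qed
  show "{} \<in> vertices ` \<Delta>" using ne down[OF _ empty_subsetI] by blast
  show "0 < den v" if "v \<in> \<Union>(vertices ` \<Delta>)" for v
    using that regT den_works(1) unfolding regular_simplex_def by blast
  show "\<exists>M\<in>vertices ` \<Delta>. S \<subseteq> M \<and> Gcd (den ` M) = 1" if S: "S \<in> vertices ` \<Delta>" for S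
  proof -
    obtain T where T: "T \<in> \<Delta>" "S = vertices T" using S by blast
    obtain M where M: "M \<in> \<Delta>" "T \<subseteq> M" and max: "\<And>N. N \<in> \<Delta> \<Longrightarrow> M \<subseteq> N \<Longrightarrow> M = N"
      using finite_has_maximal2[OF fin T(1)] by metis
    have "maximal_simplex \<Delta> M" unfolding maximal_simplex_def using M(1) max by blast
    then have "Gcd (den ` vertices M) = 1" using sreg by (simp add: strongly_regular_def)
    moreover have "M \<inter> T face_of M" using sc M(1) T(1) unfolding simplicial_complex_def by blast
    then have "T face_of M" using M(2) by (simp add: Int_absorb1)
    then have "vertices T \<subseteq> vertices M" by (rule vertices_face(1)[OF hull(1,2)[OF M(1)]])
    ultimately show ?thesis using M(1) T(2) by blast
  qed
qed

theorem strongly_regular_neighbourhood_retraction: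
  fixes \<Delta> :: "(real^'n) set set"
  assumes sc: "simplicial_complex \<Delta>" and sreg: "strongly_regular \<Delta>" and ne: "\<Delta> \<noteq> {}"
  shows "\<exists>\<sigma> U. (\<forall>i. zpl (\<lambda>x. \<sigma> x $ i)) \<and> open U \<and> \<Union>\<Delta> \<subseteq> U \<and>
    (\<forall>x\<in>U. \<sigma> x \<in> \<Union>\<Delta>) \<and> (\<forall>x\<in>\<Union>\<Delta>. \<sigma> x = x)"
proof -
  have reg: "regular \<Delta>" using sreg by (simp add: strongly_regular_def)
  have regT: "regular_simplex T" if "T \<in> \<Delta>" for T
    using reg that by (simp add: regular_def)
  note hull = regular_simplex_convex_hull[OF regT]
  define V where "V = \<Union>(vertices ` \<Delta>)"
  interpret weighted_complex V "vertices ` \<Delta>" den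
    unfolding V_def by (rule weighted_complex_strongly_regular[OF sc sreg ne])
  obtain h where h: "(\<forall>v. zpl (h v)) \<and> (\<forall>T\<in>\<Delta>. \<forall>x\<in>T.
      (\<forall>v. v \<notin> vertices T \<longrightarrow> h v x = 0) \<and> (\<forall>v\<in>vertices T. 0 \<le> h v x) \<and>
      (\<Sum>v\<in>vertices T. real (den v) * h v x) = 1 \<and>
      (\<Sum>v\<in>vertices T. (real (den v) * h v x) *\<^sub>R v) = x)"
    using regular_complex_hats(1)[OF sc reg] by (elim exE)
  then have zh: "zpl (h v)" for v by blast
  have h_out: "v \<notin> vertices T \<Longrightarrow> h v x = 0" and h_in: "v \<in> vertices T \<Longrightarrow> 0 \<le> h v x"
    and h_sum: "(\<Sum>v\<in>vertices T. real (den v) * h v x) = 1"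
    and h_pt: "(\<Sum>v\<in>vertices T. (real (den v) * h v x) *\<^sub>R v) = x"
    if "T \<in> \<Delta>" "x \<in> T" for T x v
    using h that by simp_all
  \<comment> \<open>Off the complex the extended hats may be negative, while the coordinate
    retraction expects nonnegative input.\<close>
  define y where "y x v = max 0 (h v x)" for x v
  have zy: "zpl (\<lambda>x. y x v)" for v unfolding y_def by (intro zpl_max zpl_0 zh)
  have y0: "0 \<le> y x v" for x v by (simp add: y_def)
  have onP: "y x v = h v x" "supp (y x) \<in> vertices ` \<Delta>" "mass (y x) = 1"
      "(\<Sum>v\<in>V. (real (den v) * y x v) *\<^sub>R v) = x" if x: "T \<in> \<Delta>" "x \<in> T" for x v T
  proof -
    have TV: "vertices T \<subseteq> V" using x by (auto simp: V_def)
    have y: "y x v = h v x" for v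
      using h_out[OF x, of v] h_in[OF x, of v] by (cases "v \<in> vertices T") (auto simp: y_def)
    then show "y x v = h v x" .
    have "supp (y x) \<subseteq> vertices T" using h_out[OF x] y by (fastforce simp: supp_def)
    then show "supp (y x) \<in> vertices ` \<Delta>" using K_down x(1) by blast
    have "mass (y x) = (\<Sum>v\<in>vertices T. real (den v) * h v x)"
      unfolding mass_def y using finite_V TV h_out[OF x] by (intro sum.mono_neutral_right) auto
    then show "mass (y x) = 1" using h_sum[OF x] by simp
    have "(\<Sum>v\<in>V. (real (den v) * y x v) *\<^sub>R v) = (\<Sum>v\<in>vertices T. (real (den v) * h v x) *\<^sub>R v)"
      unfolding y using finite_V TV h_out[OF x] by (intro sum.mono_neutral_right) auto
    then show "(\<Sum>v\<in>V. (real (den v) * y x v) *\<^sub>R v) = x" using h_pt[OF x] by simp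
  qed
  define \<sigma> where "\<sigma> x = (\<Sum>v\<in>V. (real (den v) * retr (y x) v) *\<^sub>R v)" for x
  \<comment> \<open>The strict inequality makes \<open>U\<close> open. It holds on the complex,
    where the defect is 0 and some coordinate is positive.\<close>
  define U where "U = (\<Union>v\<in>V. {x. 0 < y x v - real (reserve + debt_bound) * defect (y x)})"
  show ?thesis
  proof (rule exI[of _ \<sigma>], rule exI[of _ U], intro conjI allI ballI)
    show "zpl (\<lambda>x. \<sigma> x $ i)" for i
    proof -
      \<comment> \<open>Although the vertices are only rational, \<open>den v\<close> times a vertex
        \<open>v\<close> is integral.\<close>
      have "zpl (\<lambda>x. \<Sum>v\<in>V. (real (den v) * v $ i) * retr (y x) v)"
      proof (intro zpl_sum zpl_Ints_mult zpl_retr zy)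
        fix v assume "v \<in> V"
        then have "rational_point v" using regT unfolding V_def regular_simplex_def by blast
        then show "real (den v) * v $ i \<in> \<int>" by (rule den_works(2))
      qed
      moreover have "\<sigma> x $ i = (\<Sum>v\<in>V. (real (den v) * v $ i) * retr (y x) v)" for x
        by (simp add: \<sigma>_def mult_ac)
      ultimately show ?thesis by simp
    qed
    have cont: "continuous_on UNIV (\<lambda>x. y x v - real (reserve + debt_bound) * defect (y x))" for v
      by (intro continuous_zpl zpl_diff zpl_of_nat_mult zpl_defect zy)
    show "open U"
      unfolding U_def by (intro open_UN ballI open_Collect_less continuous_on_const cont)
    show "\<Union>\<Delta> \<subseteq> U"
    proof
      fix x assume "x \<in> \<Union>\<Delta>"
      then obtain T where x: "T \<in> \<Delta>" "x \<in> T" by blast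
      have "defect (y x) = 0" using onP(2,3)[OF x] y0 by (intro defect_eq_0) auto
      moreover have "\<exists>v\<in>V. 0 < y x v"
      proof (rule ccontr)
        assume "\<not> ?thesis"
        then have "y x v = 0" if "v \<in> V" for v using y0[of x v] that by force
        then have "mass (y x) = 0" by (simp add: mass_def)
        then show False using onP(3)[OF x] by simp
      qed
      ultimately show "x \<in> U" by (auto simp: U_def)
    qed
    show "\<sigma> x \<in> \<Union>\<Delta>" if xU: "x \<in> U" for x
    proof -
      obtain v where v: "v \<in> V" "y x v \<ge> real (reserve + debt_bound) * defect (y x)"
        using xU unfolding U_def by force
      note R = retr_simplex[OF y0 v]
      obtain T where T: "T \<in> \<Delta>" "supp (retr (y x)) = vertices T" using R(3) by blast
      have zero: "retr (y x) w = 0" if "w \<in> V - vertices T" for w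
        using that R(1)[of w] T(2) by (force simp: supp_def)
      have TV: "vertices T \<subseteq> V" using T(1) by (auto simp: V_def)
      have "\<sigma> x = (\<Sum>v\<in>vertices T. (real (den v) * retr (y x) v) *\<^sub>R v)"
        unfolding \<sigma>_def using finite_V TV zero by (intro sum.mono_neutral_right) auto
      also have "\<dots> \<in> convex hull (vertices T)"
      proof (intro convex_sum hull(3)[OF T(1)] convex_convex_hull)
        have "(\<Sum>v\<in>vertices T. real (den v) * retr (y x) v) = mass (retr (y x))"
          unfolding mass_def using finite_V TV zero by (intro sum.mono_neutral_left) auto
        then show "(\<Sum>v\<in>vertices T. real (den v) * retr (y x) v) = 1" using R(2) by simp
        show "0 \<le> real (den w) * retr (y x) w" if "w \<in> vertices T" for w
          using R(1)[of w] that TV by auto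
      qed (simp add: hull_inc)
      also have "convex hull (vertices T) = T" using hull(2)[OF T(1)] by simp
      finally show ?thesis using T(1) by blast
    qed
    show "\<sigma> x = x" if xP: "x \<in> \<Union>\<Delta>" for x
    proof -
      obtain T where x: "T \<in> \<Delta>" "x \<in> T" using xP by blast
      have "retr (y x) v = y x v" if "v \<in> V" for v
        using onP(2,3)[OF x] y0 that by (intro retr_fixed) auto
      then have "\<sigma> x = (\<Sum>v\<in>V. (real (den v) * y x v) *\<^sub>R v)" unfolding \<sigma>_def by (intro sum.cong) auto
      then show ?thesis using onP(4)[OF x] by simp
    qed
  qed
qed

section \<open>Retracting the cube\<close>

lemma unit_cube_eq_convex_hull: "cbox 0 (1::real^'n) = convex hull {x. \<forall>i. x $ i = 0 \<or> x $ i = 1}"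
  unfolding Cart_1 unit_interval_convex_hull[where 'a="real^'n"]
  by (rule arg_cong[where f="\<lambda>x. convex hull x"]) (simp add: Basis_vec_def inner_axis)

text \<open>A subset of least cardinality with \<open>x\<close> in its hull is affinely independent,
  since Caratheodory's theorem bounds its cardinality by its affine dimension plus 1.\<close>

lemma convex_hull_eq_Union_simplices:
  fixes E :: "'a::euclidean_space set"
  shows "convex hull E = \<Union>{convex hull D |D. D \<subseteq> E \<and> \<not> affine_dependent D}"
proof (intro equalityI subsetI)
  fix x assume "x \<in> convex hull E"
  then have "\<exists>D. finite D \<and> D \<subseteq> E \<and> x \<in> convex hull D"
    unfolding caratheodory_aff_dim[of E] by blast
  then obtain D0 where "finite D0 \<and> D0 \<subseteq> E \<and> x \<in> convex hull D0" by blast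
  from ex_has_least_nat[of "\<lambda>D. finite D \<and> D \<subseteq> E \<and> x \<in> convex hull D", OF this, of card]
  obtain D where D: "finite D" "D \<subseteq> E" "x \<in> convex hull D"
    and least: "\<And>D'. finite D' \<and> D' \<subseteq> E \<and> x \<in> convex hull D' \<Longrightarrow> card D \<le> card D'"
    by blast
  obtain D' where D': "finite D'" "D' \<subseteq> D" "int (card D') \<le> aff_dim D + 1" "x \<in> convex hull D'"
    using D(3) unfolding caratheodory_aff_dim[of D] by blast
  have "card D \<le> card D'" using least D' D(2) by blast
  then have "int (card D) \<le> aff_dim D + 1" using D'(3) by linarith
  then have "\<not> affine_dependent D"
    using D(1) aff_dim_le_card[OF D(1)] unfolding affine_independent_iff_card by linarith
  then show "x \<in> \<Union>{convex hull D |D. D \<subseteq> E \<and> \<not> affine_dependent D}" using D by blast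
next
  fix x assume "x \<in> \<Union>{convex hull D |D. D \<subseteq> E \<and> \<not> affine_dependent D}"
  then show "x \<in> convex hull E" using hull_mono by blast
qed

lemma rational_cube_polyhedron_unit_cube: "rational_cube_polyhedron (cbox 0 (1::real^'n))"
proof -
  let ?E = "{x::real^'n. \<forall>i. x $ i = 0 \<or> x $ i = 1}"
  let ?S = "{convex hull D |D. D \<subseteq> ?E \<and> \<not> affine_dependent D}"
  have "?E \<subseteq> low_den 1" by (auto simp: low_den_def mem_box_cart) (metis Ints_0 Ints_1 zero_le_one order_refl)+
  then have "finite ?E" using finite_low_den finite_subset by blast
  then have "finite ((\<lambda>D. convex hull D) ` Pow ?E)" by simp
  then have "finite ?S" by (rule rev_finite_subset) blast
  moreover have "(\<exists>m. m simplex S) \<and> S \<subseteq> cbox 0 1 \<and> (\<forall>v\<in>vertices S. rational_point v)" if S: "S \<in> ?S" for S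
  proof -
    obtain D where D: "D \<subseteq> ?E" "\<not> affine_dependent D" "S = convex hull D" using S by blast
    have "(int (card D) - 1) simplex S" using D by (auto intro!: simplex_convex_hull)
    moreover have "S \<subseteq> cbox 0 1" unfolding unit_cube_eq_convex_hull D(3) using D(1) by (rule hull_mono)
    moreover have "rational_point v" if "v \<in> vertices S" for v
    proof -
      have "v \<in> ?E" using that D vertices_convex_hull[OF D(2)] by auto
      then have "v $ i = 0 \<or> v $ i = 1" for i by blast
      then show ?thesis unfolding rational_point_def by (metis Rats_0 Rats_1)
    qed
    ultimately show ?thesis by blast
  qed
  moreover have "cbox 0 1 = \<Union>?S"
    unfolding unit_cube_eq_convex_hull by (rule convex_hull_eq_Union_simplices)
  ultimately show ?thesis unfolding rational_cube_polyhedron_def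
    by (intro exI[of _ ?S] conjI ballI) simp_all
qed

lemma Z_map_unit_cube:
  fixes \<sigma> :: "real^'n \<Rightarrow> real^'m"
  assumes \<sigma>: "\<And>i. zpl (\<lambda>x. \<sigma> x $ i)" and "\<sigma> ` cbox 0 1 \<subseteq> cbox 0 1"
  shows "Z_map (cbox 0 1) (cbox 0 1) \<sigma>"
proof -
  let ?F = "range (\<lambda>i x. \<sigma> x $ i)"
  obtain \<K> where K: "triangulation_of \<K> (cbox 0 (1::real^'n))"
    "\<forall>X\<in>\<K>. \<forall>f\<in>?F. \<exists>l. int_affine l \<and> (\<forall>x\<in>X. f x = l x)"
    by (rule zpl_triangulation[of ?F]) (use \<sigma> in auto)
  have "\<exists>(M :: real^'n^'m) (b :: real^'m).
           (\<forall>i j. M $ i $ j \<in> \<int>) \<and> (\<forall>i. b $ i \<in> \<int>) \<and> (\<forall>x\<in>T. \<sigma> x = M *v x + b)" if T: "T \<in> \<K>" for T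
  proof -
    have "\<exists>m k. (\<forall>j. m $ j \<in> \<int>) \<and> k \<in> \<int> \<and> (\<forall>x\<in>T. \<sigma> x $ i = m \<bullet> x + k)" for i
    proof -
      have "\<exists>l. int_affine l \<and> (\<forall>x\<in>T. (\<lambda>x. \<sigma> x $ i) x = l x)"
        using bspec[OF bspec[OF K(2) T], of "\<lambda>x. \<sigma> x $ i"] by blast
      then obtain l where "int_affine l" "\<forall>x\<in>T. \<sigma> x $ i = l x" by blast
      then show ?thesis unfolding int_affine_def by blast
    qed
    then have "\<forall>i. \<exists>m k. (\<forall>j. m $ j \<in> \<int>) \<and> k \<in> \<int> \<and> (\<forall>x\<in>T. \<sigma> x $ i = m \<bullet> x + k)" by blast
    from choice[OF this] obtain m where "\<forall>i. \<exists>k. (\<forall>j. m i $ j \<in> \<int>) \<and> k \<in> \<int> \<and> (\<forall>x\<in>T. \<sigma> x $ i = m i \<bullet> x + k)"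
      by blast
    from choice[OF this] obtain k where mk: "\<forall>i. (\<forall>j. m i $ j \<in> \<int>) \<and> k i \<in> \<int> \<and> (\<forall>x\<in>T. \<sigma> x $ i = m i \<bullet> x + k i)"
      by blast
    have "\<forall>x\<in>T. \<sigma> x = (\<chi> i j. m i $ j) *v x + (\<chi> i. k i)"
      using mk by (simp add: vec_eq_iff matrix_vector_mult_def inner_vec_def)
    then show ?thesis
      using mk by (intro exI[of _ "\<chi> i j. m i $ j"] exI[of _ "\<chi> i. k i"]) simp
  qed
  then show ?thesis
    unfolding Z_map_def using K(1) assms(2)
    by (intro conjI exI[of _ \<K>] ballI rational_cube_polyhedron_unit_cube)
qed

theorem theorem4p3:
  fixes P :: "(real^'n) set"
  assumes "cube_polyhedron P"
    and "\<exists>\<Delta>. triangulation_of \<Delta> P \<and> collapsible \<Delta>"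
    and "\<exists>v\<in>P. v extreme_point_of (cbox 0 1 :: (real^'n) set)"
    and "\<exists>\<Delta>. triangulation_of \<Delta> P \<and> strongly_regular \<Delta>"
  shows "Z_retract P (cbox 0 1)"
proof -
  have AR: "AR P" using assms(2) collapsible_imp_AR unfolding triangulation_of_def by blast
  obtain v0 where v0: "v0 \<in> P" "v0 extreme_point_of (cbox 0 1 :: (real^'n) set)" using assms(3) by blast
  \<comment> \<open>A vertex of the cube is a 0/1 vector, hence integral.\<close>
  have "v0 \<in> {x. \<forall>i. x $ i = 0 \<or> x $ i = 1}"
    using v0(2) unfolding unit_cube_eq_convex_hull by (rule extreme_point_of_convex_hull)
  then have v0Z: "v0 $ i \<in> \<int>" for i by (metis (mono_tags, lifting) Ints_0 Ints_1 mem_Collect_eq)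
  obtain \<Delta> where sc: "simplicial_complex \<Delta>" and P: "\<Union>\<Delta> = P" and sreg: "strongly_regular \<Delta>"
    using assms(4) unfolding triangulation_of_def by blast
  have reg: "regular \<Delta>" using sreg by (simp add: strongly_regular_def)
  have ne: "\<Delta> \<noteq> {}" using P v0(1) by blast
  have PC: "P \<subseteq> cbox 0 1" using reg P unfolding regular_def regular_simplex_def by blast
  have closed: "closed P" using closed_Union_complex[OF sc] P by simp
  then have "compact P" using PC bounded_subset[OF bounded_cbox] by (simp add: compact_eq_bounded_closed)
  obtain a where a: "zpl a \<and> (\<forall>x. 0 \<le> a x) \<and> (\<forall>x. a x = 0 \<longleftrightarrow> x \<in> P)"
    using regular_complex_hats(2)[OF sc reg] unfolding P by (elim exE)
  then have za: "zpl a" and a0: "0 \<le> a x" and aP: "a x = 0 \<longleftrightarrow> x \<in> P" for x by blast+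
  obtain \<tau> U where \<tau>U: "(\<forall>i. zpl (\<lambda>x. \<tau> x $ i)) \<and> open U \<and> P \<subseteq> U \<and>
    (\<forall>x\<in>U. \<tau> x \<in> P) \<and> (\<forall>x\<in>P. \<tau> x = x)"
    using strongly_regular_neighbourhood_retraction[OF sc sreg ne] unfolding P by (elim exE)
  then have \<tau>: "\<And>i. zpl (\<lambda>x. \<tau> x $ i)" "open U" "P \<subseteq> U"
    "\<And>x. x \<in> U \<Longrightarrow> \<tau> x \<in> P" "\<And>x. x \<in> P \<Longrightarrow> \<tau> x = x" by simp_all
  obtain e where e: "e > 0" "(\<Union>x\<in>P. ball x e) \<subseteq> U"
    using compact_subset_open_imp_ball_epsilon_subset[OF \<open>compact P\<close> \<tau>(2,3)] by blast
  \<comment> \<open>With this bound for each coordinate the l1 norm, and with it the Euclidean norm,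
    is less than \<open>e\<close>.\<close>
  have e': "e / real CARD('n) > 0" using e(1) by simp
  obtain \<rho> :: "real^'n \<Rightarrow> real^'n" where "(\<forall>i. zpl (\<lambda>x. \<rho> x $ i)) \<and> (\<forall>x\<in>P. \<rho> x = x) \<and>
    (\<forall>x\<in>cbox 0 1. \<exists>p\<in>P. \<forall>i. \<bar>\<rho> x $ i - p $ i\<bar> < e / real CARD('n))"
    using AR_approximate_retraction[OF AR closed PC za a0 aP v0(1) v0Z e'] by (elim exE)
  then have \<rho>: "\<And>i. zpl (\<lambda>x. \<rho> x $ i)" "\<And>x. x \<in> P \<Longrightarrow> \<rho> x = x"
    "\<And>x. x \<in> cbox 0 1 \<Longrightarrow> \<exists>p\<in>P. \<forall>i. \<bar>\<rho> x $ i - p $ i\<bar> < e / real CARD('n)" by simp_all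
  have \<rho>U: "\<rho> x \<in> U" if x: "x \<in> cbox 0 1" for x
  proof -
    obtain p where p: "p \<in> P" "\<And>i. \<bar>\<rho> x $ i - p $ i\<bar> < e / real CARD('n)" using \<rho>(3)[OF x] by blast
    have "norm (\<rho> x - p) \<le> (\<Sum>i\<in>UNIV. \<bar>(\<rho> x - p) $ i\<bar>)" by (rule norm_le_l1_cart)
    also have "\<dots> < (\<Sum>i\<in>(UNIV :: 'n set). e / real CARD('n))"
      using p(2) by (intro sum_strict_mono) auto
    finally have "\<rho> x \<in> ball p e" by (simp add: dist_norm norm_minus_commute)
    then show ?thesis using e(2) p(1) by blast
  qed
  \<comment> \<open>\<rho> moves the cube into \<open>U\<close> and \<tau> maps \<open>U\<close>
    into \<open>P\<close>; both fix \<open>P\<close>, so the composite is idempotent with image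
    \<open>P\<close>.\<close>
  define \<sigma> where "\<sigma> x = \<tau> (\<rho> x)" for x
  have \<sigma>P: "\<sigma> x \<in> P" if "x \<in> cbox 0 1" for x using \<tau>(4)[OF \<rho>U[OF that]] by (simp add: \<sigma>_def)
  have \<sigma>_id: "\<sigma> x = x" if "x \<in> P" for x using that \<rho>(2) \<tau>(5) by (simp add: \<sigma>_def)
  have "Z_map (cbox 0 1) (cbox 0 1) \<sigma>"
  proof (rule Z_map_unit_cube)
    show "zpl (\<lambda>x. \<sigma> x $ i)" for i
      unfolding \<sigma>_def by (rule zpl_compose[OF \<tau>(1) \<rho>(1)])
    show "\<sigma> ` cbox 0 1 \<subseteq> cbox 0 1" using \<sigma>P PC by blast
  qed
  moreover have "P = \<sigma> ` cbox 0 1"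
  proof (intro equalityI subsetI)
    show "x \<in> \<sigma> ` cbox 0 1" if "x \<in> P" for x using \<sigma>_id[OF that] PC that by (metis image_eqI subsetD)
  qed (use \<sigma>P in auto)
  ultimately show ?thesis
    unfolding Z_retract_def Z_retraction_def using \<sigma>P \<sigma>_id by blast
qed

end
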